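(* Let $-\infty\le p\le\infty$, $p\ne0$, and let $\varepsilon_p=2$ if $p>0$ and $\varepsilon_p=1$ if $p<0$. Let $\alpha\in(0,1)$ be an irrational whose continued fraction expansion $\alpha=[0;a_1,a_2,\ldots]$ satisfies $\sup_{k\in\mathbb{N}}a_{2k+\varepsilon_p}=\infty$. Then $\lim_{r\to\alpha}h_p(r)$, the limit being over rational $r$, exists and is finite. In particular, $h_p$ can be extended from $[0,1)\cap\mathbb{Q}$ to a function on $[0,1]$ which is continuous at every irrational $\alpha\in(0,1)$ that satisfies $\sup_{k\in\mathbb{N}}a_{2k+\varepsilon_p}=\infty$.
   Context: $\{x\}=x-\lfloor x\rfloor$, and $S_N(\alpha)=\sum_{n=1}^N(\{n\alpha\}-1/2)$, $S_0(\alpha)=0$. For a rational $r$ whose denominator in reduced form is $q\ge1$, define \[ J_p(r)=\left(\sum_{N=0}^{q-1}e^{pS_N(r)}\right)^{1/p}\ (p\ne\pm\infty,0),\quad J_\infty(r)=\max_{0\le N<q}e^{S_N(r)},\quad J_{-\infty}(r)=\min_{0\le N<q}e^{S_N(r)}. \] The Gauss map $T:[0,1)\to[0,1)$ is $Tx=\{1/x\}$ for $x\ne0$ and $T0=0$; $T^2$ is its second iterate. For $r\in[0,1)\cap\mathbb{Q}$, $h_p(r)=\log\frac{J_p(r)}{J_p(T^2r)}$. *)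

theory Defs
  imports Complex_Main "HOL-Library.Extended_Nat" "HOL-Library.Extended_Real"
begin

definition S :: "nat \<Rightarrow> real \<Rightarrow> real" where
  "S N x = (\<Sum>n = 1..N. frac (real n * x) - 1 / 2)"

definition reduced_denom :: "real \<Rightarrow> nat" where
  "reduced_denom r = (THE q. q > 0 \<and> (\<exists>a::int. coprime a (int q) \<and> r = of_int a / real q))"

definition J :: "ereal \<Rightarrow> real \<Rightarrow> real" where
  "J p r = (case p of
      ereal p' \<Rightarrow> (\<Sum>N = 0..<reduced_denom r. exp (p' * S N r)) powr (1 / p')
    | PInfty \<Rightarrow> Max ((\<lambda>N. exp (S N r)) ` {0..<reduced_denom r})
    | MInfty \<Rightarrow> Min ((\<lambda>N. exp (S N r)) ` {0..<reduced_denom r}))"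

definition gauss_map :: "real \<Rightarrow> real" where
  "gauss_map x = (if x = 0 then 0 else frac (1 / x))"

definition h :: "ereal \<Rightarrow> real \<Rightarrow> real" where
  "h p r = ln (J p r / J p ((gauss_map ^^ 2) r))"

text \<open>The partial quotient \<open>a\<^sub>k\<close> (for \<open>k \<ge> 1\<close>) of an irrational \<open>x\<close> in the open unit interval,
  computed by the continued fraction algorithm; \<open>cf_convergents_tendsto\<close> below confirms that
  \<open>x = [0; a\<^sub>1, a\<^sub>2, \<dots>]\<close>. The index \<open>k = 0\<close> is meaningless.\<close>

definition partial_quotient :: "real \<Rightarrow> nat \<Rightarrow> nat" where
  "partial_quotient x k = nat \<lfloor>1 / (gauss_map ^^ (k - 1)) x\<rfloor>"

definition eps :: "ereal \<Rightarrow> nat" where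
  "eps p = (if p > 0 then 2 else 1)"

text \<open>\<open>finite_cf n a = [0; a\<^sub>1, \<dots>, a\<^sub>n]\<close>\<close>

fun finite_cf :: "nat \<Rightarrow> (nat \<Rightarrow> nat) \<Rightarrow> real" where
  "finite_cf 0 a = 0"
| "finite_cf (Suc n) a = 1 / (real (a 1) + finite_cf n (\<lambda>k. a (Suc k)))"

lemma gauss_map_irrational:
  assumes "x \<in> {0<..<1} - \<rat>"
  shows "gauss_map x \<in> {0<..<1} - \<rat>"
proof -
  have x: "x > 0" "x \<notin> \<rat>" using assms by auto
  have "1 / x \<notin> \<rat>"
  proof
    assume "1 / x \<in> \<rat>"
    from Rats_divide[OF Rats_1 this] x show False by simp
  qed
  have nr: "frac (1 / x) \<notin> \<rat>"
  proof
    assume "frac (1 / x) \<in> \<rat>"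
    then have "frac (1 / x) + of_int \<lfloor>1 / x\<rfloor> \<in> \<rat>" by (intro Rats_add) auto
    with \<open>1 / x \<notin> \<rat>\<close> show False by (simp add: frac_def)
  qed
  then have "frac (1 / x) \<noteq> 0" by (metis Rats_0)
  with nr x frac_ge_0[of "1 / x"] frac_lt_1[of "1 / x"] show ?thesis
    by (simp add: gauss_map_def)
qed

lemma gauss_map_step:
  assumes "x \<in> {0<..<1} - \<rat>"
  shows "x = 1 / (real (partial_quotient x 1) + gauss_map x)" "partial_quotient x 1 \<ge> 1"
proof -
  have x: "0 < x" "x < 1" using assms by auto
  then have "\<lfloor>1 / x\<rfloor> \<ge> 1" by (simp add: le_floor_iff)
  then have "nat \<lfloor>1 / x\<rfloor> \<ge> 1" by linarith
  then show "partial_quotient x 1 \<ge> 1"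
    by (simp only: partial_quotient_def diff_self_eq_0 funpow_0)
  from \<open>\<lfloor>1 / x\<rfloor> \<ge> 1\<close> have "real (partial_quotient x 1) + gauss_map x = 1 / x"
    using x by (simp add: partial_quotient_def gauss_map_def frac_def)
  then show "x = 1 / (real (partial_quotient x 1) + gauss_map x)" by simp
qed

lemma partial_quotient_Suc:
  assumes "k \<ge> 1"
  shows "partial_quotient x (Suc k) = partial_quotient (gauss_map x) k"
  using assms by (cases k) (simp_all add: partial_quotient_def funpow_Suc_right del: funpow.simps)

lemma partial_quotient_pos:
  assumes "x \<in> {0<..<1} - \<rat>" "k \<ge> 1"
  shows "partial_quotient x k \<ge> 1"
  using assms(2,1)
proof (induction k arbitrary: x rule: dec_induct)
  case base
  then show ?case by (rule gauss_map_step(2))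
next
  case (step n)
  show ?case
    using step.IH[OF gauss_map_irrational[OF step.prems]] partial_quotient_Suc[OF step.hyps(1)]
    by simp
qed

lemma finite_cf_cong:
  "(\<And>k. k \<ge> 1 \<Longrightarrow> a k = b k) \<Longrightarrow> finite_cf n a = finite_cf n b"
proof (induction n arbitrary: a b)
  case (Suc n)
  have "finite_cf n (\<lambda>k. a (Suc k)) = finite_cf n (\<lambda>k. b (Suc k))"
    by (rule Suc.IH) (simp add: Suc.prems)
  with Suc.prems[of 1] show ?case by simp
qed simp

lemma finite_cf_partial_quotient_Suc:
  "finite_cf (Suc n) (partial_quotient x)
     = 1 / (real (partial_quotient x 1) + finite_cf n (partial_quotient (gauss_map x)))"
  using finite_cf_cong[of "\<lambda>k. partial_quotient x (Suc k)" "partial_quotient (gauss_map x)" n]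
  by (simp add: partial_quotient_Suc)

lemma finite_cf_bounds:
  assumes "x \<in> {0<..<1} - \<rat>"
  shows "0 \<le> finite_cf n (partial_quotient x) \<and> finite_cf n (partial_quotient x) \<le> 1"
  using assms
proof (induction n arbitrary: x)
  case (Suc n)
  define a where "a = real (partial_quotient x 1)"
  define c where "c = finite_cf n (partial_quotient (gauss_map x))"
  have "a \<ge> 1" using gauss_map_step(2)[OF Suc.prems] by (simp add: a_def)
  moreover have "c \<ge> 0"
    using Suc.IH[OF gauss_map_irrational[OF Suc.prems]] by (simp add: c_def)
  ultimately have "0 \<le> 1 / (a + c) \<and> 1 / (a + c) \<le> 1" by (simp add: divide_le_eq_1)
  then show ?case by (simp only: finite_cf_partial_quotient_Suc a_def c_def)
qed simp

lemma cf_error_step: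
  assumes "x \<in> {0<..<1} - \<rat>"
  shows "\<bar>x - finite_cf (Suc n) (partial_quotient x)\<bar>
     = x * finite_cf (Suc n) (partial_quotient x)
         * \<bar>gauss_map x - finite_cf n (partial_quotient (gauss_map x))\<bar>"
proof -
  define a where "a = real (partial_quotient x 1)"
  define t where "t = gauss_map x"
  define c where "c = finite_cf n (partial_quotient t)"
  have a: "a \<ge> 1" using gauss_map_step(2)[OF assms] by (simp add: a_def)
  have t: "t > 0" using gauss_map_irrational[OF assms] by (simp add: t_def)
  have c: "c \<ge> 0" using finite_cf_bounds[OF gauss_map_irrational[OF assms]] by (simp add: c_def t_def)
  have x: "x = 1 / (a + t)" using gauss_map_step(1)[OF assms] by (simp add: a_def t_def)
  have y: "finite_cf (Suc n) (partial_quotient x) = 1 / (a + c)"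
    by (simp only: finite_cf_partial_quotient_Suc a_def c_def t_def)
  have "1 / (a + t) - 1 / (a + c) = 1 / (a + t) * (1 / (a + c)) * (c - t)"
    using a t c by (simp add: field_simps)
  then have "\<bar>1 / (a + t) - 1 / (a + c)\<bar> = 1 / (a + t) * (1 / (a + c)) * \<bar>t - c\<bar>"
    using a t c by (simp add: abs_mult abs_minus_commute)
  then show ?thesis unfolding y t_def[symmetric] c_def[symmetric]
    by (simp only: x[symmetric])
qed

lemma cf_error_le:
  assumes "x \<in> {0<..<1} - \<rat>"
  shows "\<bar>x - finite_cf n (partial_quotient x)\<bar> \<le> (1 / 2) ^ (n div 2)"
  using assms
proof (induction n arbitrary: x rule: induct_nat_012)
  case 0
  then show ?case by auto
next
  case 1
  then have "\<bar>x - finite_cf (Suc 0) (partial_quotient x)\<bar> \<le> 1"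
    using finite_cf_bounds[OF 1, of "Suc 0"]
    by (auto simp: abs_le_iff simp del: finite_cf.simps)
  then show ?case by (simp del: finite_cf.simps)
next
  case (ge2 n)
  define t where "t = gauss_map x"
  define u where "u = gauss_map t"
  have t: "t \<in> {0<..<1} - \<rat>" using gauss_map_irrational[OF ge2.prems] by (simp add: t_def)
  have u: "u \<in> {0<..<1} - \<rat>" using gauss_map_irrational[OF t] by (simp add: u_def)
  define a where "a = real (partial_quotient x 1)"
  define c where "c = finite_cf (Suc n) (partial_quotient t)"
  define y where "y = finite_cf (Suc (Suc n)) (partial_quotient x)"
  define e where "e = \<bar>u - finite_cf n (partial_quotient u)\<bar>"
  have a: "a \<ge> 1" using gauss_map_step(2)[OF ge2.prems] by (simp add: a_def)
  have c: "0 \<le> c" "c \<le> 1" using finite_cf_bounds[OF t, of "Suc n"] by (simp_all only: c_def)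
  have y: "y = 1 / (a + c)"
    by (simp only: y_def finite_cf_partial_quotient_Suc a_def c_def t_def)
  have "y * c \<le> 1 / 2" "0 \<le> y * c" using a c by (auto simp: y field_simps)
  moreover have "x * t \<le> 1" "0 \<le> x * t"
    using ge2.prems t by (auto intro: mult_le_one)
  ultimately have xy: "(x * t) * (y * c) \<le> 1 * (1 / 2)"
    by (intro mult_mono) auto
  have "\<bar>x - y\<bar> = x * y * \<bar>t - c\<bar>"
    using cf_error_step[OF ge2.prems, of "Suc n"] by (simp only: y_def t_def c_def)
  also have "\<bar>t - c\<bar> = t * c * e"
    using cf_error_step[OF t, of n] by (simp only: u_def c_def e_def)
  finally have "\<bar>x - y\<bar> = (x * t) * (y * c) * e" by (simp add: mult_ac)
  also have "\<dots> \<le> 1 * (1 / 2) * e"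
    by (rule mult_right_mono[OF xy]) (simp add: e_def)
  also have "\<dots> \<le> 1 * (1 / 2) * (1 / 2) ^ (n div 2)"
    using ge2.IH(1)[OF u] by (simp add: e_def)
  finally show ?case by (simp add: y_def)
qed

lemma cf_convergents_tendsto:
  assumes "x \<in> {0<..<1} - \<rat>"
  shows "(\<lambda>n. finite_cf n (partial_quotient x)) \<longlonglongrightarrow> x"
proof -
  have "filterlim (\<lambda>n::nat. n div 2) at_top sequentially"
  proof (unfold filterlim_at_top, intro allI)
    fix Z :: nat
    show "eventually (\<lambda>n. Z \<le> n div 2) sequentially"
      by (rule eventually_sequentiallyI[of "2 * Z"]) simp
  qed
  then have "(\<lambda>n. (1 / 2 :: real) ^ (n div 2)) \<longlonglongrightarrow> 0"
    by (intro filterlim_compose[OF LIMSEQ_power_zero]) simp_all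
  then have "(\<lambda>n. finite_cf n (partial_quotient x) - x) \<longlonglongrightarrow> 0"
    by (rule tendsto_0_le[where K = 1])
      (use cf_error_le[OF assms] in \<open>simp add: abs_minus_commute\<close>)
  then show ?thesis by (simp add: LIM_zero_iff)
qed

end

theory Submission imports Defs begin

text \<open>Write \<open>T\<close> for the Gauss map. A reciprocity formula expresses \<open>S N x\<close> as
  \<open>cell x u - S M (T x)\<close> with \<open>u = N x - M\<close>, for every integer \<open>M\<close> with \<open>- x < u < 1\<close>. Grouping the
  \<open>N\<close> that belong to the same \<open>M\<close> and iterating \<open>K\<close> times turns \<open>\<Sum>\<^sub>N exp (p S N r)\<close> into a sum over
  \<open>N\<close> of \<open>exp (\<plusminus> p S N z)\<close>, \<open>z = T\<^sup>K r\<close>, weighted by a function \<open>Phi\<close> of \<open>N z\<close> modulo 1 whose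
  logarithm is Lipschitz with constant \<open>O(\<bar>p\<bar>)\<close>, uniformly in \<open>K\<close> and \<open>r\<close>. If the next partial
  quotient is large, i.e. \<open>z\<close> is small, and the sign \<open>\<plusminus>\<close> makes the exponent negative (this is the parity
  condition \<open>eps p\<close>), then \<open>exp (\<plusminus> p cell z u)\<close> is concentrated at \<open>u = 1/2\<close>. So the sum for \<open>r\<close> is nearly
  \<open>Phi\<close> at \<open>1/2\<close> times a factor depending only on \<open>z\<close>. The latter cancels in the quotient for \<open>r\<close> and
  \<open>T\<^sup>2 r\<close>, and \<open>Phi\<close> at \<open>1/2\<close> is continuous at \<open>\<alpha>\<close>. All estimates divided by \<open>p\<close> are uniform in
  \<open>\<bar>p\<bar> \<ge> 1\<close>, so the cases \<open>p = \<plusminus>\<infinity>\<close> follow by letting \<open>p\<close> tend to \<open>\<plusminus>\<infinity>\<close>.\<close>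

section \<open>Reciprocity\<close>

definition is_den :: "real \<Rightarrow> nat \<Rightarrow> bool" where
  "is_den x q \<longleftrightarrow> q > 0 \<and> real q * x \<in> \<int> \<and> (\<forall>n. 0 < n \<and> n < q \<longrightarrow> real n * x \<notin> \<int>)"

lemma is_den_unique: "is_den x q \<Longrightarrow> is_den x q' \<Longrightarrow> q = q'"
  unfolding is_den_def by (metis linorder_neqE_nat)

text \<open>By Euclid's lemma, an \<open>n\<close> making \<open>n * x\<close> integral is divisible
  by \<open>q\<close>.\<close>

lemma coprime_fraction_is_den:
  assumes "q > 0" "coprime a (int q)" "x = of_int a / real q"
  shows "is_den x q"
  unfolding is_den_def
proof (intro conjI allI impI notI)
  show "real q * x \<in> \<int>" using assms by simp
next
  fix n assume n: "0 < n \<and> n < q" and "real n * x \<in> \<int>"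
  then obtain m where "real n * x = of_int m" by (auto elim: Ints_cases)
  then have "of_int (int n * a) = (of_int (m * int q) :: real)" using assms by (simp add: field_simps)
  then have "int n * a = m * int q" by (simp only: of_int_eq_iff)
  then have "int q dvd int n * a" by simp
  then have "int q dvd int n" using assms(2) by (simp add: coprime_commute coprime_dvd_mult_left_iff)
  then show False using n by (auto dest: zdvd_imp_le)
qed (use assms in auto)

lemma is_den_reduced_denom:
  assumes "x \<in> \<rat>"
  shows "is_den x (reduced_denom x)"
proof -
  from assms obtain a b where ab: "b > 0" "coprime a b" "x = of_int a / of_int b"
    by (rule Rats_cases')
  have ex: "nat b > 0 \<and> (\<exists>a::int. coprime a (int (nat b)) \<and> x = of_int a / real (nat b))"
    using ab by auto
  have "reduced_denom x > 0 \<and> (\<exists>a::int. coprime a (int (reduced_denom x)) \<and> x = of_int a / real (reduced_denom x))"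
    unfolding reduced_denom_def
  proof (rule theI[where a = "nat b"], rule ex)
    fix q assume "q > 0 \<and> (\<exists>a::int. coprime a (int q) \<and> x = of_int a / real q)"
    with ex show "q = nat b" by (metis is_den_unique coprime_fraction_is_den)
  qed
  then show ?thesis using coprime_fraction_is_den by blast
qed

lemma gauss_map_rat: "x \<in> \<rat> \<Longrightarrow> gauss_map x \<in> \<rat>"
  by (auto simp: gauss_map_def frac_def intro!: Rats_diff Rats_divide)

lemma gauss_map_bounds: "0 \<le> gauss_map x" "gauss_map x < 1"
  by (auto simp: gauss_map_def frac_lt_1)

lemma recip_floor_gauss:
  assumes "0 < x" "x < 1"
  shows "1 / x = real (nat \<lfloor>1 / x\<rfloor>) + gauss_map x" "nat \<lfloor>1 / x\<rfloor> \<ge> 1"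
proof -
  have "\<lfloor>1 / x\<rfloor> \<ge> 1" using assms by (simp add: le_floor_iff)
  then show "1 / x = real (nat \<lfloor>1 / x\<rfloor>) + gauss_map x"
    using assms by (auto simp: gauss_map_def frac_def)
  show "nat \<lfloor>1 / x\<rfloor> \<ge> 1" using \<open>\<lfloor>1 / x\<rfloor> \<ge> 1\<close> by linarith
qed

lemma frac_add_of_int: "frac (x + of_int m) = frac x"
  by (simp add: frac_def)

text \<open>\<open>m / x\<close> and \<open>m * gauss_map x\<close> differ by the integer
  \<open>m * nat \<lfloor>1 / x\<rfloor>\<close>.\<close>

lemma frac_mult_gauss:
  assumes "0 < x" "x < 1"
  shows "frac (real m * gauss_map x) = frac (real m / x)"
proof -
  have "real m / x = real m * gauss_map x + of_int (int m * int (nat \<lfloor>1 / x\<rfloor>))"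
    using arg_cong[OF recip_floor_gauss(1)[OF assms], of "\<lambda>t. real m * t"]
    by (simp add: distrib_left)
  then show ?thesis by (simp only: frac_add_of_int)
qed

text \<open>If \<open>x\<close> is \<open>p / q\<close> in lowest terms, then
  \<open>gauss_map x\<close> is \<open>(q mod p) / p\<close>: one Euclidean step turns the numerator
  into the denominator. Minimality carries over, since an \<open>n < p\<close> with
  \<open>n * gauss_map x\<close> integral makes \<open>k = n / x\<close> a positive integer below
  \<open>q\<close> with \<open>k * x\<close> integral.\<close>

lemma is_den_gauss:
  assumes "is_den x q" "0 < x" "x < 1" "gauss_map x \<noteq> 0"
  obtains p where "is_den (gauss_map x) p" "real p = real q * x"
proof -
  define a where "a = nat \<lfloor>1 / x\<rfloor>"
  have a: "1 / x = real a + gauss_map x" using recip_floor_gauss[OF assms(2,3)] by (simp add: a_def)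
  from assms have "real q * x \<in> \<int>" "q > 0" by (auto simp: is_den_def)
  then obtain m where m: "real q * x = of_int m" by (auto elim: Ints_cases)
  have "m > 0" using m assms(2) \<open>q > 0\<close> by (metis mult_pos_pos of_int_0_less_iff of_nat_0_less_iff)
  define p where "p = nat m"
  have p: "real p = real q * x" "p > 0" using m \<open>m > 0\<close> by (auto simp: p_def)
  have gm: "real n * gauss_map x = real n / x - real n * real a" for n
    using arg_cong[OF a, of "\<lambda>t. real n * t"] by (simp add: distrib_left)
  have "real p * gauss_map x = of_int (int q - int p * int a)"
    using gm[of p] p assms(2) by simp
  then have "real p * gauss_map x \<in> \<int>" by (metis Ints_of_int)
  moreover have "real n * gauss_map x \<notin> \<int>" if n: "0 < n" "n < p" for n
  proof
    assume "real n * gauss_map x \<in> \<int>"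
    then have "real n / x - real n * real a + of_nat (n * a) \<in> \<int>" using gm[of n]
      by (metis Ints_add Ints_of_nat)
    then have "real n / x \<in> \<int>" by simp
    then obtain k where k: "real n / x = of_int k" by (auto elim: Ints_cases)
    have "k > 0" using k n assms(2) by (metis divide_pos_pos of_int_0_less_iff of_nat_0_less_iff)
    have kx: "of_int k * x = real n" using k assms(2) by (simp add: field_simps)
    have "real (nat k) * x = real n" using kx \<open>k > 0\<close> by simp
    moreover have "nat k < q"
    proof -
      have "of_int k * x < real q * x" using kx n p by simp
      then have "(of_int k :: real) < real q" using assms(2) by simp
      then show ?thesis using \<open>k > 0\<close> by linarith
    qed
    ultimately have "real (nat k) * x \<in> \<int>" "0 < nat k" "nat k < q" using \<open>k > 0\<close> by auto
    then show False using assms(1) by (auto simp only: is_den_def)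
  qed
  ultimately show ?thesis using that p by (auto simp: is_den_def)
qed

section \<open>The reciprocity formula\<close>

definition cell :: "real \<Rightarrow> real \<Rightarrow> real" where
  "cell x u = u / 2 - u * (1 - u) / (2 * x)"

lemma S_Suc: "S (Suc n) x = S n x + (frac (real (Suc n) * x) - 1 / 2)"
  by (simp add: S_def)

lemma S_0 [simp]: "S 0 x = 0"
  by (simp add: S_def)

text \<open>\<open>cell x\<close> is a quadratic polynomial that vanishes at 0 and satisfies
  \<open>cell x u - cell x (u - x) = u - 1 / 2\<close> and
  \<open>cell x u - cell x (u + 1) = - u / x - 1 / 2\<close>. These are the increments of
  \<open>S N x\<close> and of \<open>S M (gauss_map x)\<close>, so \<open>(N, M)\<close> can be
  walked down to \<open>(0, 0)\<close>: lower \<open>N\<close> when \<open>u > 0\<close>, lower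
  \<open>M\<close> when \<open>u < 0\<close>. Neither move leaves the window
  \<open>- x < u < 1\<close>.\<close>

lemma S_reciprocity:
  assumes "is_den x q" "0 < x" "x < 1" "N < q"
    and "- x < real N * x - real M" "real N * x - real M < 1"
  shows "S N x = cell x (real N * x - real M) - S M (gauss_map x)"
  using assms(4-)
proof (induction "N + M" arbitrary: N M rule: less_induct)
  case less
  define u where "u = real N * x - real M"
  consider "N = 0" "M = 0" | "u = 0" "N \<noteq> 0 \<or> M \<noteq> 0" | "u > 0" | "u < 0" by linarith
  then show ?case
  proof cases
    case 1
    then show ?thesis by (simp add: cell_def)
  next
    \<comment> \<open>Away from the origin, \<open>u = 0\<close> would make \<open>N * x\<close>
      integral with \<open>0 < N < q\<close>.\<close>
    case 2
    then have *: "real N * x = real M" by (simp add: u_def)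
    moreover have "N > 0" using 2 * assms(2) by (cases "N = 0") auto
    ultimately have "real N * x \<in> \<int>" "N > 0" by auto
    then show ?thesis using assms(1) less.prems by (auto simp: is_den_def)
  next
    case 3
    then have "N \<noteq> 0" unfolding u_def by (intro notI) simp
    then obtain n where n: "N = Suc n" by (cases N) auto
    have e: "real n * x - real M = u - x" by (simp add: u_def n algebra_simps)
    have u1: "u < 1" using less.prems by (simp add: u_def)
    have "S n x = cell x (real n * x - real M) - S M (gauss_map x)"
      by (rule less.hyps) (use less.prems e 3 u1 assms(2) n in auto)
    then have IH: "S n x = cell x (u - x) - S M (gauss_map x)" by (simp only: e)
    have "frac (real N * x) = u"
    proof -
      have "real N * x = u + of_nat M" by (simp add: u_def)
      then show ?thesis using 3 u1 by (simp add: frac_unique_iff)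
    qed
    moreover have "cell x u = cell x (u - x) + (u - 1 / 2)"
      using assms(2) by (simp add: cell_def field_simps power2_eq_square)
    ultimately have "S N x = cell x u - S M (gauss_map x)"
      using IH S_Suc[of n x] by (simp only: n)
    then show ?thesis by (simp only: u_def)
  next
    case 4
    then have "M \<noteq> 0" using assms(2) unfolding u_def by (intro notI) (simp add: mult_less_0_iff)
    then obtain m where m: "M = Suc m" by (cases M) auto
    have e: "real N * x - real m = u + 1" by (simp add: u_def m)
    have u1: "u > - x" using less.prems by (simp add: u_def)
    have "S N x = cell x (real N * x - real m) - S m (gauss_map x)"
      by (rule less.hyps) (use less.prems e 4 u1 assms(2,3) m in auto)
    then have IH: "S N x = cell x (u + 1) - S m (gauss_map x)" by (simp only: e)
    have "frac (real M * gauss_map x) = - u / x"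
    proof -
      have "real M / x = - u / x + of_nat N" using assms(2) by (simp add: u_def field_simps)
      moreover have "0 \<le> - u / x" "- u / x < 1" using u1 4 assms(2) by (auto simp: field_simps)
      ultimately have "frac (real M / x) = - u / x" by (simp add: frac_unique_iff)
      then show ?thesis using frac_mult_gauss[OF assms(2,3)] by simp
    qed
    moreover have "cell x u = cell x (u + 1) + (- u / x - 1 / 2)"
      using assms(2) by (simp add: cell_def field_simps power2_eq_square)
    ultimately have "S N x = cell x u - S M (gauss_map x)"
      using IH S_Suc[of m "gauss_map x"] by (simp only: m)
    then show ?thesis by (simp only: u_def)
  qed
qed

text \<open>Reflecting \<open>n\<close> to \<open>q - n\<close> replaces each fractional part by its
  complement to 1, so the sum equals its own negative.\<close>

lemma S_last:
  assumes "is_den x q"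
  shows "S (q - 1) x = 0"
proof -
  have "S (q - 1) x = (\<Sum>n = 1..q - 1. frac (real (q - n) * x) - 1 / 2)"
    unfolding S_def
    by (rule sum.reindex_bij_witness[of _ "\<lambda>n. q - n" "\<lambda>n. q - n"]) auto
  also have "\<dots> = (\<Sum>n = 1..q - 1. - (frac (real n * x) - 1 / 2))"
  proof (rule sum.cong)
    fix n assume n: "n \<in> {1..q - 1}"
    then have "real n * x \<notin> \<int>" "real q * x \<in> \<int>" using assms by (auto simp: is_den_def)
    then obtain m where m: "real q * x = of_int m" by (auto elim: Ints_cases)
    have "real (q - n) * x = of_int m + (- (real n * x))"
      using n m by (subst of_nat_diff) (auto simp: left_diff_distrib)
    then have "frac (real (q - n) * x) = frac (- (real n * x))"
      using frac_add_of_int[of "- (real n * x)" m] by (simp add: add.commute)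
    also have "\<dots> = 1 - frac (real n * x)" using \<open>real n * x \<notin> \<int>\<close> by (simp add: frac_neg)
    finally show "frac (real (q - n) * x) - 1 / 2 = - (frac (real n * x) - 1 / 2)" by simp
  qed simp
  also have "\<dots> = - S (q - 1) x" by (simp only: S_def sum_negf)
  finally show ?thesis by simp
qed

section \<open>Transfer along the Gauss map\<close>

text \<open>A weight family \<open>g\<close> assigns to a displacement \<open>u = N x - M\<close> a weight for each of two states, as in
  the Ostrowski numeration: \<open>True\<close> (\<open>u > 1 - x\<close>) means that the digit is maximal, which forces the
  digit one level below to vanish. If the fractional part \<open>t\<close> of \<open>N x\<close> exceeds \<open>1 - x\<close>, both
  \<open>u = t\<close> (state \<open>True\<close>) and \<open>u = t - 1\<close> (state \<open>False\<close>) contribute. The boundary \<open>t = 1 - x\<close> occurs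
  only for the last index \<open>N\<close>; the flag \<open>c\<close> chooses its state, and the extra summand of \<open>fsum\<close>
  accounts for a virtual index \<open>N = reduced_denom x\<close> with \<open>u = 1\<close>. The two conventions alternate
  from level to level.\<close>

definition wt :: "real \<Rightarrow> real \<Rightarrow> (bool \<Rightarrow> real \<Rightarrow> real) \<Rightarrow> bool \<Rightarrow> real \<Rightarrow> real" where
  "wt s x g st u = exp (s * cell x u) * g st u"

text \<open>The transfer operator of the Gauss map. For fixed \<open>M\<close>, with
  \<open>t\<close> the displacement one level below, the indices \<open>N\<close> have displacements
  \<open>x * (b - t)\<close> for consecutive digits \<open>b\<close>; this is the computation in
  \<open>column_index\<close>. The maximal digit \<open>nat \<lfloor>1 / x\<rfloor>\<close> leads to
  state \<open>True\<close>.\<close>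

definition nxt :: "real \<Rightarrow> real \<Rightarrow> (bool \<Rightarrow> real \<Rightarrow> real) \<Rightarrow> bool \<Rightarrow> real \<Rightarrow> real" where
  "nxt s x g st t = (if st then wt s x g False (- x * t)
     else (\<Sum>b<nat \<lfloor>1 / x\<rfloor>. wt s x g False (x * (real b - t)))
          + wt s x g True (x * (real (nat \<lfloor>1 / x\<rfloor>) - t)))"

definition fibre :: "bool \<Rightarrow> real \<Rightarrow> (bool \<Rightarrow> real \<Rightarrow> real) \<Rightarrow> real \<Rightarrow> real" where
  "fibre c x g t = (if t < 1 - x \<or> c \<and> t = 1 - x then g False t else g True t + g False (t - 1))"

definition fsum :: "bool \<Rightarrow> real \<Rightarrow> real \<Rightarrow> (bool \<Rightarrow> real \<Rightarrow> real) \<Rightarrow> real" where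
  "fsum c s x g = (\<Sum>N<reduced_denom x. exp (s * S N x) * fibre c x g (frac (real N * x)))
     + (if c then exp (s / 2) * g True 1 else 0)"

lemma nxt_False: "nxt s x g False t = (\<Sum>b<nat \<lfloor>1 / x\<rfloor> + 1. wt s x g (b = nat \<lfloor>1 / x\<rfloor>) (x * (real b - t)))"
  by (simp add: nxt_def)

lemma nxt_True: "nxt s x g True t = wt s x g False (- x * t)"
  by (simp add: nxt_def)

text \<open>Digit 0 from state \<open>True\<close> at \<open>t\<close> and the digits from state
  \<open>False\<close> at \<open>t - 1\<close>, shifted up by one, join to a single run of
  consecutive digits.\<close>

lemma nxt_True_False:
  "nxt s x g True t + nxt s x g False (t - 1) = (\<Sum>b<nat \<lfloor>1 / x\<rfloor> + 2. wt s x g (b = nat \<lfloor>1 / x\<rfloor> + 1) (x * (real b - t)))"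
proof -
  have "(\<Sum>b<Suc (nat \<lfloor>1 / x\<rfloor> + 1). wt s x g (b = nat \<lfloor>1 / x\<rfloor> + 1) (x * (real b - t)))
     = wt s x g False (- x * t) + (\<Sum>b<nat \<lfloor>1 / x\<rfloor> + 1. wt s x g (b = nat \<lfloor>1 / x\<rfloor>) (x * (real b - (t - 1))))"
    by (subst sum.lessThan_Suc_shift) (simp add: algebra_simps)
  then show ?thesis by (simp add: nxt_False nxt_True)
qed

locale gauss_step =
  fixes x :: real and q p :: nat
  assumes x: "0 < x" "x < 1" and q: "is_den x q" and p: "is_den (gauss_map x) p"
    and pq: "real p = real q * x" and y0: "gauss_map x \<noteq> 0"
begin

abbreviation (input) "y \<equiv> gauss_map x"

definition "a = nat \<lfloor>1 / x\<rfloor>"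

text \<open>An array to be summed in two orders: rows lead to the sum at level \<open>x\<close>,
  columns to the sum at level \<open>gauss_map x\<close>. By reciprocity a nonzero entry is
  \<open>exp (s * S N x) * g st u\<close>. The value \<open>u = 1 - x\<close> is left out because it
  arises only from the last index \<open>N = q - 1\<close>, which is treated apart.\<close>

definition G :: "real \<Rightarrow> (bool \<Rightarrow> real \<Rightarrow> real) \<Rightarrow> nat \<Rightarrow> nat \<Rightarrow> real" where
  "G s g N M = exp (- s * S M y) * (let u = real N * x - real M in
     if - x < u \<and> u < 1 - x then wt s x g False u
     else if 1 - x < u \<and> u < 1 then wt s x g True u else 0)"

lemma a: "1 / x = real a + y" "a \<ge> 1"
  using recip_floor_gauss[OF x] by (auto simp: a_def)

lemma xa: "x * (real a + y) = 1"
  using a x by (simp flip: a(1))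

lemma y: "0 < y" "y < 1"
  using gauss_map_bounds[of x] y0 by auto

lemma p_ge: "p \<ge> 2"
proof (rule ccontr)
  assume "\<not> p \<ge> 2"
  moreover have "p > 0" using p by (simp add: is_den_def)
  ultimately have "p = 1" by linarith
  then have "y \<in> \<int>" using p by (simp add: is_den_def)
  then obtain k where "y = of_int k" by (auto elim: Ints_cases)
  then show False using y by simp
qed

lemma pq_less: "p < q"
proof -
  have "q > 0" using q by (simp add: is_den_def)
  then have "real p < real q * 1" unfolding pq using x by (intro mult_strict_left_mono) auto
  then show ?thesis by simp
qed

lemma Suc_mult_noninteger: "Suc N < q \<Longrightarrow> real N * x + x \<noteq> of_int m"
  using q[unfolded is_den_def] Ints_of_int[of m]
  by (metis add.commute distrib_right mult_1 of_nat_Suc zero_less_Suc)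

text \<open>For fixed \<open>N\<close> only \<open>M = \<lfloor>N * x\<rfloor>\<close> puts
  \<open>u\<close> into the window, joined by the next integer when the fractional part exceeds
  \<open>1 - x\<close>. As \<open>N\<close> is not the last index, the boundary value
  \<open>1 - x\<close> does not occur.\<close>

lemma row_sum:
  assumes N: "Suc N < q"
  shows "exp (s * S N x) * fibre c x g (frac (real N * x)) = (\<Sum>M<p. G s g N M)"
proof -
  define m where "m = nat \<lfloor>real N * x\<rfloor>"
  define t where "t = frac (real N * x)"
  have t: "0 \<le> t" "t < 1" by (auto simp: t_def frac_lt_1)
  have Nx: "real N * x = real m + t" using x by (simp add: m_def t_def frac_def)
  have tx: "t \<noteq> 1 - x"
    using Suc_mult_noninteger[OF N, of "int m + 1"] Nx by auto
  have Sq: "real (Suc N) * x < real p" unfolding pq using N x by (intro mult_strict_right_mono) auto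
  have "real m < real p" using Sq Nx t x by (simp add: algebra_simps)
  then have mp: "m < p" by simp
  have recip: "exp (s * S N x) = exp (- s * S M y) * exp (s * cell x (real N * x - real M))"
    if "- x < real N * x - real M" "real N * x - real M < 1" for M
    using S_reciprocity[OF q x _ that] N by (simp add: exp_add[symmetric] right_diff_distrib)
  have Gm: "G s g N M = 0" if Mm: "M \<noteq> m" "M \<noteq> Suc m \<or> t < 1 - x" for M
  proof -
    have "\<not> (- x < real N * x - real M \<and> real N * x - real M < 1)"
    proof (cases "M < m")
      case True
      then have "real M \<le> real m - 1" by linarith
      then show ?thesis using Nx t by linarith
    next
      case False
      then consider "M = Suc m" "t < 1 - x" | "M \<ge> m + 2"
        using Mm by (cases "M = Suc m") auto
      then show ?thesis
      proof cases
        case 2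
        then have "real M \<ge> real m + 2" by linarith
        then show ?thesis using Nx t x by linarith
      qed (use Nx in auto)
    qed
    then show ?thesis using x by (auto simp: G_def Let_def)
  qed
  show ?thesis
  proof (cases "t < 1 - x")
    case True
    have "(\<Sum>M<p. G s g N M) = (\<Sum>M\<in>{m}. G s g N M)"
      by (rule sum.mono_neutral_right) (use mp Gm True in auto)
    also have "\<dots> = exp (s * S N x) * g False t"
      using recip[of m] Nx t True x by (simp add: G_def wt_def)
    finally show ?thesis using True by (simp add: fibre_def flip: t_def)
  next
    case False
    then have t1: "t > 1 - x" using tx by simp
    have "real (Suc m) < real p" using Sq Nx t1 by (simp add: algebra_simps)
    then have Smp: "Suc m < p" by simp
    have "(\<Sum>M<p. G s g N M) = (\<Sum>M\<in>{m, Suc m}. G s g N M)"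
      by (rule sum.mono_neutral_right) (use mp Smp Gm t1 in auto)
    also have "\<dots> = exp (s * S N x) * (g True t + g False (t - 1))"
    proof -
      have "G s g N m = exp (s * S N x) * g True t"
        using recip[of m] Nx t t1 x by (simp add: G_def wt_def)
      moreover have "G s g N (Suc m) = exp (s * S N x) * g False (t - 1)"
        using recip[of "Suc m"] Nx t t1 x by (simp add: G_def wt_def Let_def)
      ultimately show ?thesis by (simp add: distrib_left)
    qed
    finally show ?thesis using t1 by (simp add: fibre_def flip: t_def)
  qed
qed

lemma column_index:
  "real (nat \<lfloor>real M / x\<rfloor> + b) * x - real M = x * (real b - frac (real M * y))"
proof -
  have "real (nat \<lfloor>real M / x\<rfloor>) = real M / x - frac (real M * y)"
    using x by (simp add: frac_mult_gauss) (simp add: frac_def)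
  then show ?thesis using x by (simp add: field_simps)
qed

text \<open>For fixed \<open>M\<close> the admissible \<open>N\<close> form a run of
  \<open>B\<close> integers starting at \<open>\<lfloor>M / x\<rfloor>\<close>. The value
  \<open>B = a\<close> belongs to \<open>M = p - 1\<close>: there digit \<open>a\<close> would give
  \<open>u = 1 - x\<close>, that is \<open>N = q - 1\<close>, which is outside the range of
  \<open>N\<close>.\<close>

lemma column_sum:
  fixes M
  defines "t \<equiv> frac (real M * y)"
  defines "B \<equiv> (if t < 1 - y then a + 1 else if t > 1 - y then a + 2 else a)"
  assumes M: "M < p" "Suc M < p \<longleftrightarrow> t \<noteq> 1 - y"
  shows "(\<Sum>N<q-1. G s g N M) = exp (- s * S M y) *
     (\<Sum>b<B. wt s x g (b = B - 1 \<and> t \<noteq> 1 - y) (x * (real b - t)))"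
proof -
  define n where "n = nat \<lfloor>real M / x\<rfloor>"
  have ix: "real (n + b) * x - real M = x * (real b - t)" for b
    unfolding n_def t_def by (rule column_index)
  have t: "0 \<le> t" "t < 1" by (auto simp: t_def frac_lt_1)
  \<comment> \<open>By \<open>x * (a + y) = 1\<close> the window condition becomes
    \<open>b < a + y + t\<close>, and comparing \<open>t\<close> with \<open>1 - y\<close> counts
    its integer solutions.\<close>
  have B: "x * (real b - t) < 1 \<and> (t = 1 - y \<longrightarrow> x * (real b - t) < 1 - x) \<longleftrightarrow> b < B" for b
  proof -
    have "x * (real b - t) < 1 \<longleftrightarrow> x * (real b - t) < x * (real a + y)" by (simp only: xa)
    also have "\<dots> \<longleftrightarrow> real b < real a + y + t" using x by auto
    finally have 1: "x * (real b - t) < 1 \<longleftrightarrow> real b < real a + y + t" .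
    have "x * (real b - t) < 1 - x \<longleftrightarrow> x * (real b - t) < x * (real a + y - 1)"
      using xa by (simp add: algebra_simps)
    also have "\<dots> \<longleftrightarrow> real b < real a + y + t - 1" using x by auto
    finally have 2: "x * (real b - t) < 1 - x \<longleftrightarrow> real b < real a + y + t - 1" .
    consider "t < 1 - y" | "t > 1 - y" | "t = 1 - y" by linarith
    then show ?thesis
    proof cases
      case 1
      then have "real b < real a + y + t \<longleftrightarrow> b < a + 1" using y t by (auto; linarith)
      then show ?thesis using 1 \<open>x * (real b - t) < 1 \<longleftrightarrow> real b < real a + y + t\<close> by (simp add: B_def)
    next
      case 2
      then have "real b < real a + y + t \<longleftrightarrow> b < a + 2" using y t by (auto; linarith)
      then show ?thesis using 2 \<open>x * (real b - t) < 1 \<longleftrightarrow> real b < real a + y + t\<close> by (simp add: B_def)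
    next
      case 3
      then show ?thesis using 1 2 by (auto simp: B_def)
    qed
  qed
  have pos: "- x < x * (real b - t)" for b
  proof -
    have "x * (- 1) < x * (real b - t)" using x t by (intro mult_strict_left_mono) auto
    then show ?thesis by simp
  qed
  have G0: "G s g N M = 0" if N: "N < q - 1" "N \<notin> {n..<n + B}" for N
  proof -
    have "\<not> (- x < real N * x - real M \<and> real N * x - real M < 1)"
    proof (cases "N < n")
      case True
      then have "real N \<le> real n - 1" by linarith
      then have "real N * x \<le> (real n - 1) * x" using x by (intro mult_right_mono) auto
      also have "\<dots> = real M - x * t - x" using ix[of 0] by (simp add: algebra_simps)
      also have "\<dots> \<le> real M - x" using x t by simp
      finally show ?thesis by auto
    next
      case False
      define b where "b = N - n"
      have b: "N = n + b" "\<not> b < B" using False N by (auto simp: b_def)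
      show ?thesis
      proof (cases "t = 1 - y")
        case True
        then have MS: "Suc M = p" using M by auto
        have "Suc N < q" using N by simp
        then have "(real N + 1) * x < real p" unfolding pq using x by (intro mult_strict_right_mono) auto
        then have "real N * x - real M < 1 - x" using MS by (auto simp: algebra_simps)
        then have "x * (real b - t) < 1 - x" using ix[of b] b by simp
        then have False using B[of b] b x by auto
        then show ?thesis ..
      next
        case False
        then show ?thesis using B[of b] b ix[of b] by auto
      qed
    qed
    then show ?thesis using x by (auto simp: G_def Let_def)
  qed
  have sub: "{n..<n + B} \<subseteq> {..<q - 1}"
  proof
    fix N assume "N \<in> {n..<n + B}"
    then obtain b where b: "N = n + b" "b < B" by (metis atLeastLessThan_iff le_Suc_ex nat_add_left_cancel_less)
    have "(real N + 1) * x < real p"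
    proof (cases "t = 1 - y")
      case True
      then have "x * (real b - t) < 1 - x" using B[of b] b by auto
      then have "real N * x - real M < 1 - x" using ix[of b] b by simp
      moreover have "real M + 1 \<le> real p" using M(1) by linarith
      ultimately show ?thesis by (simp add: algebra_simps)
    next
      case False
      then have "Suc M < p" using M by simp
      then have "real M + 2 \<le> real p" by linarith
      moreover have "real N * x - real M < 1" using ix[of b] b B[of b] by simp
      ultimately show ?thesis using x by (simp add: algebra_simps)
    qed
    then have "(real N + 1) < real q" unfolding pq using x by simp
    then show "N \<in> {..<q - 1}" by auto
  qed
  have "(\<Sum>N<q-1. G s g N M) = (\<Sum>N\<in>{n..<n + B}. G s g N M)"
    by (rule sum.mono_neutral_right) (use sub G0 in auto)
  also have "\<dots> = (\<Sum>b<B. G s g (n + b) M)"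
    by (rule sum.reindex_bij_witness[of _ "\<lambda>b. n + b" "\<lambda>N. N - n"]) auto
  also have "\<dots> = (\<Sum>b<B. exp (- s * S M y) * wt s x g (b = B - 1 \<and> t \<noteq> 1 - y) (x * (real b - t)))"
  proof (rule sum.cong)
    fix b assume "b \<in> {..<B}"
    then have b: "b < B" by simp
    have u: "- x < x * (real b - t)" "x * (real b - t) < 1" using pos B[of b] b by auto
    have "x * (real b - t) < 1 - x \<longleftrightarrow> x * (real b - t) < x * (real a + y - 1)"
      using xa by (simp add: algebra_simps)
    also have "\<dots> \<longleftrightarrow> real b < real a + y + t - 1" using x by auto
    finally have 2: "x * (real b - t) < 1 - x \<longleftrightarrow> real b < real a + y + t - 1" .
    have "1 - x < x * (real b - t) \<longleftrightarrow> x * (real a + y - 1) < x * (real b - t)"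
      using xa by (simp add: algebra_simps)
    also have "\<dots> \<longleftrightarrow> real b > real a + y + t - 1" using x by auto
    finally have 3: "1 - x < x * (real b - t) \<longleftrightarrow> real b > real a + y + t - 1" .
    have 4: "x * (real b - t) < 1 - x \<longleftrightarrow> \<not> (b = B - 1 \<and> t \<noteq> 1 - y)"
      unfolding 2 using b y t a(2) by (auto simp: B_def split: if_splits)
    have 5: "1 - x < x * (real b - t) \<longleftrightarrow> (b = B - 1 \<and> t \<noteq> 1 - y)"
      unfolding 3 using b y t a(2) by (auto simp: B_def split: if_splits)
    show "G s g (n + b) M = exp (- s * S M y) * wt s x g (b = B - 1 \<and> t \<noteq> 1 - y) (x * (real b - t))"
      unfolding G_def Let_def ix 
      using u 4 5 by (cases "b = B - 1 \<and> t \<noteq> 1 - y") (simp_all only: simp_thms if_True if_False)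
  qed simp
  finally show ?thesis by (simp add: sum_distrib_left)
qed


lemma cell_simps: "cell x (1 - x) = 0" "cell x (- x) = 1 / 2" "cell x 1 = 1 / 2"
  using x by (auto simp: cell_def field_simps)

lemma frac_last: "frac (real (q - 1) * x) = 1 - x" "frac (real (p - 1) * y) = 1 - y"
proof -
  have *: "frac (real (n - 1) * z) = 1 - z" if n: "is_den z n" and z: "0 < z" "z < 1" for z n
  proof -
    from n have "n > 0" "real n * z \<in> \<int>" by (auto simp: is_den_def)
    then obtain m where "real n * z = of_int m" by (auto elim: Ints_cases)
    then have "real (n - 1) * z = (1 - z) + of_int (m - 1)"
      using \<open>n > 0\<close> by (simp add: of_nat_diff left_diff_distrib)
    then have "frac (real (n - 1) * z) = frac (1 - z)" by (simp only: frac_add_of_int)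
    then show ?thesis using z by (simp add: frac_eq)
  qed
  show "frac (real (q - 1) * x) = 1 - x" "frac (real (p - 1) * y) = 1 - y"
    using *[OF q x] *[OF p y] by auto
qed

lemma frac_not_last:
  assumes "Suc M < p"
  shows "frac (real M * y) \<noteq> 1 - y"
proof
  assume "frac (real M * y) = 1 - y"
  then have "real M * y = 1 - y + of_int \<lfloor>real M * y\<rfloor>" by (simp add: frac_def)
  then have "real (Suc M) * y = of_int (1 + \<lfloor>real M * y\<rfloor>)" by (simp add: algebra_simps)
  then have "real (Suc M) * y \<in> \<int>" by (metis Ints_of_int)
  then show False using p assms unfolding is_den_def by blast
qed

lemma is_den_imp_reduced_denom: "is_den z n \<Longrightarrow> reduced_denom z = n"
proof (rule is_den_unique[OF is_den_reduced_denom])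
  assume z: "is_den z n"
  then have "real n * z \<in> \<rat>" "n > 0" using Ints_subset_Rats by (auto simp: is_den_def)
  then have "real n * z / real n \<in> \<rat>" by (intro Rats_divide) auto
  then show "z \<in> \<rat>" using \<open>n > 0\<close> by simp
qed

text \<open>Both sides contain the total of \<open>G\<close> over \<open>N < q - 1\<close> and
  \<open>M < p\<close>, taken by rows and by columns. What remains are the terms at
  \<open>u = 1 - x\<close>, \<open>u = - x\<close> and \<open>u = 1\<close>, made explicit by
  \<open>S_last\<close> and \<open>cell_simps\<close>.\<close>

lemma fsum_step: "fsum c s x g = fsum (\<not> c) (- s) y (nxt s x g)"
proof -
  define C where "C M = (\<Sum>N<q-1. G s g N M)" for M
  define D where "D = (\<Sum>b<a. wt s x g False (x * (real b - (1 - y))))"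
  have qp: "Suc (q - 1) = q" "Suc (p - 1) = p" using p_ge pq_less by auto
  have C1: "C M = exp (- s * S M y) * fibre c' y (nxt s x g) (frac (real M * y))" if "M < p - 1" for M c'
  proof -
    have M: "Suc M < p" using that by simp
    define t where "t = frac (real M * y)"
    have t: "t \<noteq> 1 - y" using frac_not_last[OF M] by (simp add: t_def)
    have "C M = exp (- s * S M y) * (\<Sum>b<(if t < 1 - y then a + 1 else a + 2).
        wt s x g (b = (if t < 1 - y then a + 1 else a + 2) - 1) (x * (real b - t)))"
      using column_sum[of M s g, folded t_def] M t by (simp add: C_def)
    also have "\<dots> = exp (- s * S M y) * fibre c' y (nxt s x g) t"
      using t nxt_True_False[of s x g t, folded a_def] nxt_False[of s x g t, folded a_def] by (auto simp: fibre_def)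
    finally show ?thesis by (simp add: t_def)
  qed
  have C2: "C (p - 1) = D"
  proof -
    have "C (p - 1) = exp (- s * S (p - 1) y) * D"
      using column_sum[of "p - 1" s g, unfolded frac_last] qp p_ge by (simp add: C_def D_def)
    then show ?thesis using S_last[OF p] by simp
  qed
  have "fsum c s x g = (\<Sum>N<Suc (q - 1). exp (s * S N x) * fibre c x g (frac (real N * x)))
      + (if c then exp (s / 2) * g True 1 else 0)"
    by (simp only: fsum_def is_den_imp_reduced_denom[OF q] qp)
  also have "\<dots> = (\<Sum>N<q-1. exp (s * S N x) * fibre c x g (frac (real N * x)))
      + fibre c x g (1 - x) + (if c then exp (s / 2) * g True 1 else 0)"
    using S_last[OF q] frac_last by simp
  also have "(\<Sum>N<q-1. exp (s * S N x) * fibre c x g (frac (real N * x))) = (\<Sum>N<q-1. \<Sum>M<p. G s g N M)"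
    by (intro sum.cong row_sum) auto
  also have "\<dots> = (\<Sum>M<p. C M)"
    unfolding C_def by (rule sum.swap)
  also have "\<dots> = (\<Sum>M<Suc (p - 1). C M)" by (simp only: qp)
  also have "\<dots> = (\<Sum>M<p-1. exp (- s * S M y) * fibre (\<not> c) y (nxt s x g) (frac (real M * y))) + D"
    using C1[where c' = "\<not> c"] C2 by simp
  finally have L: "fsum c s x g = (\<Sum>M<p-1. exp (- s * S M y) * fibre (\<not> c) y (nxt s x g) (frac (real M * y)))
     + D + fibre c x g (1 - x) + (if c then exp (s / 2) * g True 1 else 0)" .
  have "fsum (\<not> c) (- s) y (nxt s x g)
      = (\<Sum>M<Suc (p - 1). exp (- s * S M y) * fibre (\<not> c) y (nxt s x g) (frac (real M * y)))
      + (if \<not> c then exp (- s / 2) * nxt s x g True 1 else 0)"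
    by (simp only: fsum_def is_den_imp_reduced_denom[OF p] qp)
  also have "\<dots> = (\<Sum>M<p-1. exp (- s * S M y) * fibre (\<not> c) y (nxt s x g) (frac (real M * y)))
      + fibre (\<not> c) y (nxt s x g) (1 - y) + (if \<not> c then exp (- s / 2) * nxt s x g True 1 else 0)"
    using S_last[OF p] frac_last by simp
  finally have R: "fsum (\<not> c) (- s) y (nxt s x g)
      = (\<Sum>M<p-1. exp (- s * S M y) * fibre (\<not> c) y (nxt s x g) (frac (real M * y)))
      + (fibre (\<not> c) y (nxt s x g) (1 - y) + (if \<not> c then exp (- s / 2) * nxt s x g True 1 else 0))"
    by simp
  \<comment> \<open>This is where the two conventions alternate. With \<open>c\<close>, digits
    \<open>a\<close> and \<open>a + 1\<close> over \<open>M = p - 1\<close> give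
    \<open>u = 1 - x\<close> and \<open>u = 1\<close>, matching the last index at level
    \<open>x\<close> in state \<open>False\<close> and the virtual index. Without \<open>c\<close>,
    digit \<open>a\<close> accounts for state \<open>True\<close> at \<open>1 - x\<close>, and the
    virtual index one level below accounts for state \<open>False\<close> at
    \<open>- x\<close>.\<close>
  have "fibre (\<not> c) y (nxt s x g) (1 - y) + (if \<not> c then exp (- s / 2) * nxt s x g True 1 else 0)
      = D + fibre c x g (1 - x) + (if c then exp (s / 2) * g True 1 else 0)"
  proof (cases c)
    case True
    have "x * (real a - (1 - y)) = 1 - x" "x * (real (a + 1) - (1 - y)) = 1"
      using xa by (auto simp: algebra_simps)
    then have "nxt s x g True (1 - y) + nxt s x g False (1 - y - 1)
       = D + g False (1 - x) + exp (s / 2) * g True 1"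
      unfolding nxt_True_False a_def[symmetric] using a(2) by (simp add: D_def wt_def cell_simps)
    then show ?thesis using True by (simp add: fibre_def)
  next
    case False
    have "x * (real a - (1 - y)) = 1 - x" using xa by (auto simp: algebra_simps)
    then have "nxt s x g False (1 - y) = D + g True (1 - x)"
      by (simp add: nxt_False D_def wt_def cell_simps flip: a_def)
    moreover have "exp (- s / 2) * nxt s x g True 1 = g False (- x)"
      by (simp add: nxt_True wt_def cell_simps flip: exp_add mult.assoc)
    ultimately show ?thesis using False by (simp add: fibre_def)
  qed
  then show ?thesis unfolding L R by simp
qed

end

section \<open>Iteration to depth \<open>K\<close>\<close>

primrec Phi :: "real \<Rightarrow> real \<Rightarrow> nat \<Rightarrow> bool \<Rightarrow> real \<Rightarrow> real" where
  "Phi p x 0 = (\<lambda>st t. if st then 0 else 1)"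
| "Phi p x (Suc K) = nxt ((- 1) ^ K * p) ((gauss_map ^^ K) x) (Phi p x K)"

lemma gauss_map_funpow_rat: "x \<in> \<rat> \<Longrightarrow> (gauss_map ^^ K) x \<in> \<rat>"
  by (induction K) (auto intro: gauss_map_rat)

text \<open>The initial weight gives every fibre the value 1 and vanishes in state
  \<open>True\<close>, so at depth 0 either value of the flag represents the sum. Hence
  \<open>c\<close> is free, and with it the flag at depth \<open>K\<close>.\<close>

lemma birkhoff_sum_eq_fsum:
  assumes "x \<in> \<rat>" "\<And>i. i \<le> K \<Longrightarrow> (gauss_map ^^ i) x \<in> {0<..<1}"
  shows "(\<Sum>N<reduced_denom x. exp (p * S N x))
    = fsum (c = even K) ((- 1) ^ K * p) ((gauss_map ^^ K) x) (Phi p x K)"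
  using assms(2)
proof (induction K)
  case 0
  show ?case by (auto simp: fsum_def fibre_def intro!: sum.cong)
next
  case (Suc K)
  let ?z = "(gauss_map ^^ K) x"
  have z: "0 < ?z" "?z < 1" "gauss_map ?z \<noteq> 0" using Suc.prems[of K] Suc.prems[of "Suc K"] by auto
  have den: "is_den ?z (reduced_denom ?z)"
    by (intro is_den_reduced_denom gauss_map_funpow_rat assms(1))
  obtain p' where p': "is_den (gauss_map ?z) p'" "real p' = real (reduced_denom ?z) * ?z"
    using is_den_gauss[OF den z] by blast
  interpret gauss_step ?z "reduced_denom ?z" p'
    by unfold_locales (use z den p' in auto)
  have "(\<Sum>N<reduced_denom x. exp (p * S N x)) = fsum (c = even K) ((- 1) ^ K * p) ?z (Phi p x K)"
    by (rule Suc.IH) (use Suc.prems in auto)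
  also have "\<dots> = fsum (c = even (Suc K)) ((- 1) ^ Suc K * p) ((gauss_map ^^ Suc K) x) (Phi p x (Suc K))"
    by (subst fsum_step) simp
  finally show ?case .
qed

section \<open>Log-Lipschitz bounds\<close>

definition Dom :: "bool \<Rightarrow> real \<Rightarrow> real set" where
  "Dom st x = (if st then {1 - x..1} else {- x..1 - x})"

text \<open>A Lipschitz bound for \<open>ln (g st u)\<close> on each domain, written
  multiplicatively so that weights may vanish.\<close>

definition log_lip :: "real \<Rightarrow> real \<Rightarrow> (bool \<Rightarrow> real \<Rightarrow> real) \<Rightarrow> bool" where
  "log_lip R x g \<longleftrightarrow> (\<forall>st. \<forall>u\<in>Dom st x. 0 \<le> g st u \<and> (\<forall>v\<in>Dom st x. g st u \<le> exp (R * \<bar>u - v\<bar>) * g st v))"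

lemma log_lipI:
  assumes "\<And>st u. u \<in> Dom st x \<Longrightarrow> 0 \<le> g st u"
    and "\<And>st u v. u \<in> Dom st x \<Longrightarrow> v \<in> Dom st x \<Longrightarrow> g st u \<le> exp (R * \<bar>u - v\<bar>) * g st v"
  shows "log_lip R x g"
  unfolding log_lip_def by (intro allI ballI conjI assms)

lemma log_lipD:
  assumes "log_lip R x g" "u \<in> Dom st x"
  shows "0 \<le> g st u" and "v \<in> Dom st x \<Longrightarrow> g st u \<le> exp (R * \<bar>u - v\<bar>) * g st v"
  using assms by (simp_all add: log_lip_def)

lemma cell_diff:
  assumes "0 < x" "x < 1" "\<bar>u\<bar> \<le> 1" "\<bar>v\<bar> \<le> 1"
  shows "\<bar>cell x u - cell x v\<bar> \<le> 2 * \<bar>u - v\<bar> / x"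
proof -
  have "cell x u - cell x v = (u - v) * ((x - 1 + (u + v)) / (2 * x))"
    using assms(1) by (simp add: cell_def field_simps)
  then have "\<bar>cell x u - cell x v\<bar> = \<bar>u - v\<bar> * (\<bar>x - 1 + (u + v)\<bar> / (2 * x))"
    using assms(1) by (simp add: abs_mult)
  also have "\<dots> \<le> \<bar>u - v\<bar> * (4 / (2 * x))"
    using assms by (intro mult_left_mono divide_right_mono) auto
  finally show ?thesis by (simp add: mult.commute)
qed

lemma wt_nonneg: "0 \<le> g st u \<Longrightarrow> 0 \<le> wt s x g st u"
  by (simp add: wt_def)

lemma Dom_abs_le: "0 < x \<Longrightarrow> x < 1 \<Longrightarrow> u \<in> Dom st x \<Longrightarrow> \<bar>u\<bar> \<le> 1"
  by (auto simp: Dom_def split: if_splits)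

text \<open>The slope of \<open>cell x\<close> is of order \<open>1 / x\<close>, but displacements
  at level \<open>x\<close> differ by \<open>x\<close> times those one level below, so the factor
  \<open>x\<close> cancels.\<close>

lemma wt_log_lip:
  assumes x: "0 < x" "x < 1" and g: "log_lip R x g"
    and uv: "u \<in> Dom st x" "v \<in> Dom st x" "\<bar>u - v\<bar> = x * d"
  shows "wt s x g st u \<le> exp ((2 * \<bar>s\<bar> + x * R) * d) * wt s x g st v"
proof -
  have "s * (cell x u - cell x v) \<le> \<bar>s\<bar> * \<bar>cell x u - cell x v\<bar>"
    by (metis abs_ge_self abs_mult)
  also have "\<dots> \<le> \<bar>s\<bar> * (2 * \<bar>u - v\<bar> / x)"
    by (intro mult_left_mono cell_diff) (use x Dom_abs_le uv in auto)
  also have "\<dots> = 2 * \<bar>s\<bar> * d" using uv x by simp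
  finally have 1: "s * cell x u \<le> 2 * \<bar>s\<bar> * d + s * cell x v" by (simp add: right_diff_distrib)
  have "0 \<le> g st u" "g st u \<le> exp (R * \<bar>u - v\<bar>) * g st v"
    using log_lipD[OF g uv(1)] uv(2) by simp_all
  then have 2: "0 \<le> g st u" "g st u \<le> exp (R * (x * d)) * g st v" by (simp_all only: uv(3))
  have "wt s x g st u \<le> exp (2 * \<bar>s\<bar> * d + s * cell x v) * (exp (R * (x * d)) * g st v)"
    unfolding wt_def using 1 2 by (intro mult_mono) auto
  also have "\<dots> = exp ((2 * \<bar>s\<bar> + x * R) * d) * wt s x g st v"
    by (simp add: wt_def distrib_left distrib_right exp_add mult_ac)
  finally show ?thesis .
qed

lemma Dom_digit:
  assumes x: "0 < x" "x < 1"
  shows "t \<in> Dom False (gauss_map x) \<Longrightarrow> b < nat \<lfloor>1 / x\<rfloor> \<Longrightarrow> x * (real b - t) \<in> Dom False x"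
    and "t \<in> Dom False (gauss_map x) \<Longrightarrow> x * (real (nat \<lfloor>1 / x\<rfloor>) - t) \<in> Dom True x"
    and "t \<in> Dom True (gauss_map x) \<Longrightarrow> - x * t \<in> Dom False x"
proof -
  define a where "a = nat \<lfloor>1 / x\<rfloor>"
  define y where "y = gauss_map x"
  have a: "1 / x = real a + y" "a \<ge> 1" using recip_floor_gauss[OF x] by (auto simp: a_def y_def)
  have xa: "x * (real a + y) = 1" using x by (simp flip: a(1))
  have y: "0 \<le> y" "y < 1" using gauss_map_bounds by (auto simp: y_def)
  {
    assume t: "t \<in> Dom False (gauss_map x)" and b: "b < nat \<lfloor>1 / x\<rfloor>"
    have "x * (real b - t) \<le> x * (real a + y - 1)" "x * (real b - t) \<ge> x * (- 1)"
      using t b x y unfolding y_def[symmetric] a_def[symmetric]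
      by (intro mult_left_mono; simp add: Dom_def; linarith)+
    then show "x * (real b - t) \<in> Dom False x" using xa by (simp add: Dom_def algebra_simps)
  next
    assume t: "t \<in> Dom False (gauss_map x)"
    have "x * (real a - t) \<le> x * (real a + y)" "x * (real a - t) \<ge> x * (real a + y - 1)"
      using t x y unfolding y_def[symmetric] by (auto intro!: mult_left_mono simp: Dom_def)
    then show "x * (real (nat \<lfloor>1 / x\<rfloor>) - t) \<in> Dom True x" unfolding a_def[symmetric]
      using xa by (simp add: Dom_def algebra_simps)
  next
    assume t: "t \<in> Dom True (gauss_map x)"
    have "x * t \<le> x * 1" "x * t \<ge> 0"
      using t x y unfolding y_def[symmetric] by (auto intro!: mult_left_mono simp: Dom_def)
    then show "- x * t \<in> Dom False x" using x by (simp add: Dom_def)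
  }
qed

text \<open>Each summand moves by \<open>x * \<bar>u - v\<bar>\<close>, and log-Lipschitz bounds
  survive addition. The old constant is damped by \<open>x\<close>, while the new exponential
  contributes \<open>2 * \<bar>s\<bar>\<close> however small \<open>x\<close> is.\<close>

lemma nxt_log_lip:
  assumes x: "0 < x" "x < 1" and g: "log_lip R x g"
  shows "log_lip (2 * \<bar>s\<bar> + x * R) (gauss_map x) (nxt s x g)"
proof -
  have nn: "0 \<le> g st u" if "u \<in> Dom st x" for st u
    by (rule log_lipD(1)[OF g that])
  have "0 \<le> nxt s x g st u" if u: "u \<in> Dom st (gauss_map x)" for st u
  proof (cases st)
    case True
    then show ?thesis using u by (simp only: nxt_def if_True) (rule wt_nonneg, rule nn, rule Dom_digit(3)[OF x], simp)
  next
    case False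
    then have "u \<in> Dom False (gauss_map x)" using u by simp
    note uF = this
    have "0 \<le> (\<Sum>b<nat \<lfloor>1 / x\<rfloor>. wt s x g False (x * (real b - u)))"
    proof (rule sum_nonneg)
      fix b assume "b \<in> {..<nat \<lfloor>1 / x\<rfloor>}"
      then have b: "b < nat \<lfloor>1 / x\<rfloor>" by (rule lessThan_iff[THEN iffD1])
      show "0 \<le> wt s x g False (x * (real b - u))" by (rule wt_nonneg, rule nn, rule Dom_digit(1)[OF x uF b])
    qed
    moreover have "0 \<le> wt s x g True (x * (real (nat \<lfloor>1 / x\<rfloor>) - u))"
      by (rule wt_nonneg, rule nn, rule Dom_digit(2)[OF x uF])
    ultimately show ?thesis unfolding nxt_def using False by (simp only: if_False add_nonneg_nonneg)
  qed
  moreover have "nxt s x g st u \<le> exp ((2 * \<bar>s\<bar> + x * R) * \<bar>u - v\<bar>) * nxt s x g st v"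
    if u: "u \<in> Dom st (gauss_map x)" and v: "v \<in> Dom st (gauss_map x)" for st u v
  proof -
    have e: "\<bar>x * (b - u) - x * (b - v)\<bar> = x * \<bar>u - v\<bar>" for b
    proof -
      have "x * (b - u) - x * (b - v) = - (x * (u - v))" by (simp add: algebra_simps)
      then show ?thesis using x by (simp only: abs_minus_cancel abs_mult abs_of_pos)
    qed
    show ?thesis
    proof (cases st)
      case True
      then have "- x * u \<in> Dom False x" "- x * v \<in> Dom False x" using u v Dom_digit(3)[OF x] by (simp_all only:)
      moreover have "\<bar>- x * u - - x * v\<bar> = x * \<bar>u - v\<bar>" using e[of 0] by simp
      ultimately show ?thesis using wt_log_lip[OF x g] True by (simp only: nxt_def if_True)
    next
      case False
      then have uv: "u \<in> Dom False (gauss_map x)" "v \<in> Dom False (gauss_map x)" using u v by auto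
      let ?A = "nat \<lfloor>1 / x\<rfloor>" and ?e = "exp ((2 * \<bar>s\<bar> + x * R) * \<bar>u - v\<bar>)"
      have "(\<Sum>b<?A. wt s x g False (x * (real b - u))) \<le> (\<Sum>b<?A. ?e * wt s x g False (x * (real b - v)))"
      proof (rule sum_mono)
        fix b assume "b \<in> {..<?A}"
        then have b: "b < ?A" by (rule lessThan_iff[THEN iffD1])
        show "wt s x g False (x * (real b - u)) \<le> ?e * wt s x g False (x * (real b - v))"
          by (rule wt_log_lip[OF x g Dom_digit(1)[OF x uv(1) b] Dom_digit(1)[OF x uv(2) b] e])
      qed
      moreover have "wt s x g True (x * (real ?A - u)) \<le> ?e * wt s x g True (x * (real ?A - v))"
        by (rule wt_log_lip[OF x g Dom_digit(2)[OF x uv(1)] Dom_digit(2)[OF x uv(2)] e])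
      ultimately show ?thesis
        using False by (simp only: nxt_def if_False distrib_left sum_distrib_left add_mono)
    qed
  qed
  ultimately show ?thesis by (rule log_lipI)
qed

text \<open>State \<open>True\<close> uses digit 0 only, and digit 0 is also among the summands of
  state \<open>False\<close>; the two displacements are at most \<open>2 * x\<close> apart.\<close>

lemma nxt_True_le_False:
  assumes x: "0 < x" "x < 1" and g: "log_lip R x g" and R: "R \<ge> 0"
    and t: "t \<in> Dom True (gauss_map x)" "t' \<in> Dom False (gauss_map x)"
  shows "nxt s x g True t \<le> exp ((2 * \<bar>s\<bar> + x * R) * 2) * nxt s x g False t'"
proof -
  have nn: "0 \<le> g st u" if "u \<in> Dom st x" for st u
    by (rule log_lipD(1)[OF g that])
  have a: "0 < nat \<lfloor>1 / x\<rfloor>" using recip_floor_gauss[OF x] by linarith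
  have d: "- x * t \<in> Dom False x" "- x * t' \<in> Dom False x"
    using Dom_digit(3)[OF x t(1)] Dom_digit(1)[OF x t(2) a] by auto
  have "\<bar>- x * t - - x * t'\<bar> = x * \<bar>t - t'\<bar>"
  proof -
    have "- x * t - - x * t' = - (x * (t - t'))" by (simp add: algebra_simps)
    then show ?thesis using x by (simp only: abs_minus_cancel abs_mult abs_of_pos)
  qed
  from wt_log_lip[OF x g d this]
  have "nxt s x g True t \<le> exp ((2 * \<bar>s\<bar> + x * R) * \<bar>t - t'\<bar>) * wt s x g False (- x * t')"
    by (simp add: nxt_def)
  also have "\<dots> \<le> exp ((2 * \<bar>s\<bar> + x * R) * 2) * wt s x g False (- x * t')"
  proof (intro mult_right_mono wt_nonneg nn d)
    have "\<bar>t - t'\<bar> \<le> 2" using t gauss_map_bounds[of x] by (auto simp: Dom_def)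
    then show "exp ((2 * \<bar>s\<bar> + x * R) * \<bar>t - t'\<bar>) \<le> exp ((2 * \<bar>s\<bar> + x * R) * 2)"
      using mult_left_mono[of "\<bar>t - t'\<bar>" 2 "2 * \<bar>s\<bar> + x * R"] x R by simp
  qed
  also have "wt s x g False (- x * t') \<le> nxt s x g False t'"
  proof -
    have "wt s x g False (x * (real 0 - t')) \<le> (\<Sum>b<nat \<lfloor>1 / x\<rfloor>. wt s x g False (x * (real b - t')))"
      by (rule member_le_sum) (use a in \<open>auto intro!: wt_nonneg nn Dom_digit(1)[OF x t(2)]\<close>)
    moreover have "0 \<le> wt s x g True (x * (real (nat \<lfloor>1 / x\<rfloor>) - t'))"
      by (intro wt_nonneg nn Dom_digit(2)[OF x t(2)])
    ultimately show ?thesis by (simp add: nxt_def)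
  qed
  finally show ?thesis by (simp add: mult_left_mono)
qed

lemma nxt_False_pos:
  assumes x: "0 < x" "x < 1" and g: "log_lip R x g" and pos: "\<And>u. u \<in> Dom False x \<Longrightarrow> 0 < g False u"
    and t: "t \<in> Dom False (gauss_map x)"
  shows "0 < nxt s x g False t"
proof -
  have nn: "0 \<le> g st u" if "u \<in> Dom st x" for st u
    by (rule log_lipD(1)[OF g that])
  have a: "0 < nat \<lfloor>1 / x\<rfloor>" using recip_floor_gauss[OF x] by linarith
  have "0 < (\<Sum>b<nat \<lfloor>1 / x\<rfloor>. wt s x g False (x * (real b - t)))"
  proof (rule sum_pos)
    show "{..<nat \<lfloor>1 / x\<rfloor>} \<noteq> {}" using a by (auto simp only: lessThan_empty_iff)
  qed (auto simp: wt_def intro!: mult_pos_pos pos Dom_digit(1)[OF x t])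
  moreover have "0 \<le> wt s x g True (x * (real (nat \<lfloor>1 / x\<rfloor>) - t))"
    by (intro wt_nonneg nn Dom_digit(2)[OF x t])
  ultimately show ?thesis by (simp add: nxt_def)
qed

text \<open>In \<open>x * (a + gauss_map x) = 1\<close> the digit \<open>a\<close> is at least 1 and
  hence exceeds \<open>gauss_map x\<close>.\<close>

lemma mult_gauss_map_le:
  assumes "0 < x" "x < 1"
  shows "gauss_map x * x \<le> 1 / 2"
proof -
  define y where "y = gauss_map x"
  have "x * (real (nat \<lfloor>1 / x\<rfloor>) + y) = 1" "1 \<le> real (nat \<lfloor>1 / x\<rfloor>)" 
    using recip_floor_gauss[OF assms] assms by (simp_all add: field_simps flip: y_def)
  moreover have "x * 1 \<le> x * real (nat \<lfloor>1 / x\<rfloor>)" using assms calculation(2) by (intro mult_left_mono) auto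
  moreover have "x * y \<le> x * 1" using assms gauss_map_bounds[of x] by (intro mult_left_mono) (auto simp: y_def)
  ultimately show ?thesis by (simp add: y_def algebra_simps)
qed

text \<open>The products of two consecutive iterates are at most \<open>1/2\<close>, so the Lipschitz constants
  stay bounded along the recursion.\<close>

lemma Phi_log_lip:
  assumes "\<And>i. i < K \<Longrightarrow> (gauss_map ^^ i) x \<in> {0<..<1}"
  shows "log_lip (case K of 0 \<Rightarrow> 0 | Suc i \<Rightarrow> 4 * \<bar>p\<bar> * (1 + (gauss_map ^^ i) x)) ((gauss_map ^^ K) x) (Phi p x K)"
  using assms
proof (induction K)
  case 0
  show ?case by (auto simp: log_lip_def)
next
  case (Suc K)
  let ?z = "(gauss_map ^^ K) x"
  define R where "R = (case K of 0 \<Rightarrow> 0 | Suc i \<Rightarrow> 4 * \<bar>p\<bar> * (1 + (gauss_map ^^ i) x))"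
  have z: "0 < ?z" "?z < 1" using Suc.prems[of K] by auto
  have IH: "log_lip R ?z (Phi p x K)" unfolding R_def by (rule Suc.IH) (use Suc.prems in auto)
  have L: "log_lip (2 * \<bar>p\<bar> + ?z * R) (gauss_map ?z) (nxt ((- 1) ^ K * p) ?z (Phi p x K))"
    using nxt_log_lip[OF z IH, of "(- 1) ^ K * p"] by (simp add: abs_mult)
  \<comment> \<open>A constant \<open>4 * \<bar>p\<bar> * (1 + w)\<close>, with \<open>w\<close> the
    previous iterate, reproduces its shape: times \<open>?z\<close> it is at most
    \<open>4 * \<bar>p\<bar> * ?z + 2 * \<bar>p\<bar>\<close>.\<close>
  have "2 * \<bar>p\<bar> + ?z * R \<le> 4 * \<bar>p\<bar> * (1 + ?z)"
  proof (cases K)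
    case 0
    have "2 * \<bar>p\<bar> * 1 \<le> 2 * \<bar>p\<bar> * (2 * (1 + ?z))" using z by (intro mult_left_mono) auto
    then show ?thesis using 0 by (simp add: R_def algebra_simps)
  next
    case (Suc i)
    have w: "0 < (gauss_map ^^ i) x" "(gauss_map ^^ i) x < 1" using Suc.prems[of i] Suc by auto
    have "?z * (gauss_map ^^ i) x \<le> 1 / 2" using mult_gauss_map_le[OF w] Suc by simp
    then have "4 * \<bar>p\<bar> * (?z * (gauss_map ^^ i) x) \<le> 4 * \<bar>p\<bar> * (1 / 2)" by (intro mult_left_mono) auto
    then show ?thesis unfolding R_def Suc by (simp add: algebra_simps)
  qed
  then have le: "exp ((2 * \<bar>p\<bar> + ?z * R) * \<bar>u - v\<bar>) \<le> exp (4 * \<bar>p\<bar> * (1 + ?z) * \<bar>u - v\<bar>)" for u v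
    by (simp add: mult_right_mono)
  have "Phi p x (Suc K) st u \<le> exp (4 * \<bar>p\<bar> * (1 + ?z) * \<bar>u - v\<bar>) * Phi p x (Suc K) st v"
    if "u \<in> Dom st (gauss_map ?z)" "v \<in> Dom st (gauss_map ?z)" for st u v
  proof -
    from L that have "0 \<le> Phi p x (Suc K) st v"
      "Phi p x (Suc K) st u \<le> exp ((2 * \<bar>p\<bar> + ?z * R) * \<bar>u - v\<bar>) * Phi p x (Suc K) st v"
      unfolding Phi.simps using log_lipD[OF L] by simp_all
    then show ?thesis using mult_right_mono[OF le[of u v]] order.trans by blast
  qed
  moreover have "0 \<le> Phi p x (Suc K) st u" if "u \<in> Dom st (gauss_map ?z)" for st u
    unfolding Phi.simps by (rule log_lipD(1)[OF L that])
  ultimately show ?case unfolding nat.case funpow.simps o_apply by (intro log_lipI) simp_all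
qed

text \<open>Iterates below 1 make the Lipschitz constant at most \<open>8 * \<bar>p\<bar>\<close>,
  and points of one domain are at distance at most 2, whence \<open>16 * \<bar>p\<bar>\<close>.
  Across the states the comparison is \<open>nxt_True_le_False\<close>; at depth 0 state
  \<open>True\<close> has weight 0.\<close>

lemma Phi_bounds:
  assumes K: "\<And>i. i < K \<Longrightarrow> (gauss_map ^^ i) x \<in> {0<..<1}"
    and v: "v \<in> Dom False ((gauss_map ^^ K) x)"
  shows "u \<in> Dom st ((gauss_map ^^ K) x) \<Longrightarrow> 0 \<le> Phi p x K st u"
    and "u \<in> Dom False ((gauss_map ^^ K) x) \<Longrightarrow> Phi p x K False u \<le> exp (8 * \<bar>p\<bar> * \<bar>u - v\<bar>) * Phi p x K False v"
    and "u \<in> Dom st ((gauss_map ^^ K) x) \<Longrightarrow> Phi p x K st u \<le> exp (16 * \<bar>p\<bar>) * Phi p x K False v"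
    and "0 < Phi p x K False v"
proof -
  define R where "R K = (case K of 0 \<Rightarrow> 0 | Suc i \<Rightarrow> 4 * \<bar>p\<bar> * (1 + (gauss_map ^^ i) x))" for K
  have L: "log_lip (R n) ((gauss_map ^^ n) x) (Phi p x n)" if "n \<le> K" for n
    unfolding R_def by (rule Phi_log_lip) (use K that in auto)
  have R: "0 \<le> R n" "R n \<le> 8 * \<bar>p\<bar>" if "n \<le> K" for n
  proof -
    have "0 \<le> R n \<and> R n \<le> 8 * \<bar>p\<bar>"
    proof (cases n)
      case (Suc i)
      then have "0 \<le> (gauss_map ^^ i) x" "(gauss_map ^^ i) x \<le> 1" using K[of i] that by auto
      then have "4 * \<bar>p\<bar> * (1 + (gauss_map ^^ i) x) \<le> 4 * \<bar>p\<bar> * 2" "0 \<le> 4 * \<bar>p\<bar> * (1 + (gauss_map ^^ i) x)"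
        by (intro mult_left_mono mult_nonneg_nonneg; simp)+
      then show ?thesis unfolding R_def Suc by simp
    qed (simp add: R_def)
    then show "0 \<le> R n" "R n \<le> 8 * \<bar>p\<bar>" by auto
  qed
  show nn: "0 \<le> Phi p x K st u" if "u \<in> Dom st ((gauss_map ^^ K) x)" for st u
    by (rule log_lipD(1)[OF L[OF order.refl] that])
  have lip: "Phi p x K False u \<le> exp (8 * \<bar>p\<bar> * \<bar>u - v\<bar>) * Phi p x K False v"
    if "u \<in> Dom False ((gauss_map ^^ K) x)" for u
  proof -
    have "Phi p x K False u \<le> exp (R K * \<bar>u - v\<bar>) * Phi p x K False v"
      by (rule log_lipD(2)[OF L[OF order.refl] that v])
    also have "\<dots> \<le> exp (8 * \<bar>p\<bar> * \<bar>u - v\<bar>) * Phi p x K False v"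
      using R[of K] nn[OF v] by (intro mult_right_mono) (auto simp: mult_right_mono)
    finally show ?thesis .
  qed
  then show "u \<in> Dom False ((gauss_map ^^ K) x) \<Longrightarrow> Phi p x K False u \<le> exp (8 * \<bar>p\<bar> * \<bar>u - v\<bar>) * Phi p x K False v" .
  show "Phi p x K st u \<le> exp (16 * \<bar>p\<bar>) * Phi p x K False v" if u: "u \<in> Dom st ((gauss_map ^^ K) x)"
  proof (cases st)
    case False
    have "\<bar>u - v\<bar> \<le> 2" using u v False by (auto simp: Dom_def)
    then have "8 * \<bar>p\<bar> * \<bar>u - v\<bar> \<le> 8 * \<bar>p\<bar> * 2" by (intro mult_left_mono) auto
    then have "exp (8 * \<bar>p\<bar> * \<bar>u - v\<bar>) \<le> exp (8 * \<bar>p\<bar> * 2)" by simp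
    then have "exp (8 * \<bar>p\<bar> * \<bar>u - v\<bar>) * Phi p x K False v \<le> exp (8 * \<bar>p\<bar> * 2) * Phi p x K False v"
      using nn[OF v] by (rule mult_right_mono)
    then show ?thesis using lip u False by force
  next
    case True
    show ?thesis
    proof (cases K)
      case 0
      then show ?thesis using True by simp
    next
      case (Suc n)
      let ?z = "(gauss_map ^^ n) x"
      have z: "0 < ?z" "?z < 1" using K[of n] Suc by auto
      have "Phi p x K True u \<le> exp ((2 * \<bar>(- 1) ^ n * p\<bar> + ?z * R n) * 2) * Phi p x K False v"
        using nxt_True_le_False[OF z L[of n] R(1)[of n]] u v True Suc by simp
      also have "\<dots> \<le> exp (16 * \<bar>p\<bar>) * Phi p x K False v"
      proof (intro mult_right_mono nn v)
        have "2 * \<bar>p\<bar> + ?z * R n \<le> 8 * \<bar>p\<bar>"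
        proof (cases n)
          case 0
          then show ?thesis by (simp add: R_def)
        next
          case (Suc i)
          have w: "0 < (gauss_map ^^ i) x" "(gauss_map ^^ i) x < 1" using K[of i] Suc \<open>K = Suc n\<close> by auto
          have "?z * (gauss_map ^^ i) x \<le> 1 / 2" using mult_gauss_map_le[OF w] Suc by simp
          then have "4 * \<bar>p\<bar> * (?z * (gauss_map ^^ i) x) \<le> 4 * \<bar>p\<bar> * (1 / 2)" by (intro mult_left_mono) auto
          moreover have "4 * \<bar>p\<bar> * ?z \<le> 4 * \<bar>p\<bar> * 1" using z by (intro mult_left_mono) auto
          ultimately show ?thesis unfolding R_def Suc by (simp add: algebra_simps)
        qed
        then show "exp ((2 * \<bar>(- 1) ^ n * p\<bar> + ?z * R n) * 2) \<le> exp (16 * \<bar>p\<bar>)"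
          by (simp add: abs_mult mult.commute)
      qed
      finally show ?thesis using True by simp
    qed
  qed
  have "0 < Phi p x n False w" if "n \<le> K" "w \<in> Dom False ((gauss_map ^^ n) x)" for n w
    using that
  proof (induction n arbitrary: w)
    case (Suc n)
    let ?z = "(gauss_map ^^ n) x"
    have z: "0 < ?z" "?z < 1" using K[of n] Suc.prems by auto
    show ?case using nxt_False_pos[OF z L[of n]] Suc by simp
  qed simp
  then show "0 < Phi p x K False v" using v by simp
qed

section \<open>Concentration\<close>

lemma fibre_nxt_eq:
  fixes t x
  defines "n \<equiv> (if t < 1 - gauss_map x then nat \<lfloor>1 / x\<rfloor> + 1 else nat \<lfloor>1 / x\<rfloor> + 2)"
  shows "fibre False (gauss_map x) (nxt s x g) t = (\<Sum>b<n. wt s x g (b = n - 1) (x * (real b - t)))"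
  using nxt_False[of s x g t] nxt_True_False[of s x g t] by (auto simp: fibre_def n_def)

lemma fibre_digit_Dom:
  fixes t x
  defines "n \<equiv> (if t < 1 - gauss_map x then nat \<lfloor>1 / x\<rfloor> + 1 else nat \<lfloor>1 / x\<rfloor> + 2)"
  assumes x: "0 < x" "x < 1" and t: "0 \<le> t" "t < 1" and b: "b < n"
  shows "x * (real b - t) \<in> Dom (b = n - 1) x"
proof -
  define a where "a = nat \<lfloor>1 / x\<rfloor>"
  have low: "x * (real b - t) \<in> Dom (b = a) x" if "b < a + 1" "t \<in> Dom False (gauss_map x)" for b t
    using Dom_digit(1)[OF x that(2), of b] Dom_digit(2)[OF x that(2)] that(1)
    unfolding a_def[symmetric] by (cases "b = a") auto
  show ?thesis
  proof (cases "t < 1 - gauss_map x")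
    case True
    then have "t \<in> Dom False (gauss_map x)" using t gauss_map_bounds[of x] by (simp add: Dom_def)
    then show ?thesis using low b True by (simp add: n_def flip: a_def)
  next
    case False
    then have t': "t \<in> Dom True (gauss_map x)" "t - 1 \<in> Dom False (gauss_map x)"
      using t gauss_map_bounds[of x] by (auto simp: Dom_def)
    show ?thesis
    proof (cases b)
      case 0
      then show ?thesis using Dom_digit(3)[OF x t'(1)] False by (simp add: n_def)
    next
      case (Suc c)
      then show ?thesis using low[OF _ t'(2), of c] b False by (simp add: n_def algebra_simps flip: a_def)
    qed
  qed
qed

text \<open>Completing the square shows that for negative \<open>s\<close> the factor
  \<open>exp (s * cell x u)\<close> is a narrow Gaussian about \<open>u = 1 / 2\<close>, up to a
  constant and the factor \<open>exp (s * u / 2)\<close>.\<close>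

lemma cell_centred: "0 < x \<Longrightarrow> cell x u = u / 2 - (1 / 4 - (u - 1 / 2)\<^sup>2) / (2 * x)"
  by (simp add: cell_def field_simps power2_eq_square)

text \<open>Bounds the relative mass of the digits with \<open>\<bar>u - 1 / 2\<bar> > d\<close>:
  they number at most \<open>1 / x + 2\<close>, and each is compared with a digit within
  \<open>x\<close> of the centre. The 1 in the exponent absorbs the linear term \<open>u / 2\<close>
  of \<open>cell\<close> at both places.\<close>

definition conc_err :: "real \<Rightarrow> real \<Rightarrow> real \<Rightarrow> real" where
  "conc_err s d x = (1 / x + 2) * exp (\<bar>s\<bar> * (1 - (d\<^sup>2 - x\<^sup>2) / (2 * x)))"

text \<open>The point is that \<open>w\<close> is independent of \<open>g\<close>, so that it cancels when two weight families
  are compared.\<close>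

lemma fibre_concentration:
  assumes x: "0 < x" "x \<le> d / 2" and d: "d < 1 / 4" and s: "s < 0" and t: "0 \<le> t" "t < 1"
  obtains w where "w > 0"
    "\<And>g \<Gamma> k l. \<Gamma> \<ge> 0 \<Longrightarrow>
      (\<And>u. \<bar>u - 1 / 2\<bar> \<le> d \<Longrightarrow> exp (- k) * \<Gamma> \<le> g False u \<and> g False u \<le> exp k * \<Gamma>) \<Longrightarrow>
      (\<And>st u. u \<in> Dom st x \<Longrightarrow> 0 \<le> g st u \<and> g st u \<le> exp l * \<Gamma>) \<Longrightarrow>
      exp (- k) * \<Gamma> * w \<le> fibre False (gauss_map x) (nxt s x g) t \<and>
      fibre False (gauss_map x) (nxt s x g) t \<le> (exp k + conc_err s d x * exp l) * \<Gamma> * w"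
proof -
  define a where "a = nat \<lfloor>1 / x\<rfloor>"
  define n where "n = (if t < 1 - gauss_map x then nat \<lfloor>1 / x\<rfloor> + 1 else nat \<lfloor>1 / x\<rfloor> + 2)"
  define u where "u b = x * (real b - t)" for b
  define E where "E b = exp (s * cell x (u b))" for b
  define C where "C = {b. b < n \<and> \<bar>u b - 1 / 2\<bar> \<le> d}"
  define w where "w = sum E C"
  have x1: "x < 1" "x < 1 / 8" using x d by auto
  have a: "1 / x = real a + gauss_map x" using recip_floor_gauss[OF x(1) x1(1)] by (simp add: a_def)
  have n: "a + 1 \<le> n" "real n \<le> 1 / x + 2" using a gauss_map_bounds[of x] by (auto simp: n_def a_def)
  have dom: "u b \<in> Dom (b = n - 1) x" if "b < n" for b
    using fibre_digit_Dom[OF x(1) x1(1) t, of b] that by (simp add: n_def u_def)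
  have E: "E b > 0" for b by (simp add: E_def)
  have E_eq: "E b = exp (\<bar>s\<bar> * ((1 / 4 - (u b - 1 / 2)\<^sup>2) / (2 * x) - u b / 2))" for b
  proof -
    have "s * cell x (u b) = \<bar>s\<bar> * (- cell x (u b))" using s by simp
    then show ?thesis by (simp only: E_def cell_centred[OF x(1)] minus_diff_eq)
  qed
  have fC: "finite C" by (simp add: C_def)
  \<comment> \<open>The first digit with \<open>u \<ge> 1 / 2\<close>; as digits are spaced by
    \<open>x\<close>, it overshoots by at most \<open>x\<close>.\<close>
  define b0 where "b0 = nat \<lceil>1 / (2 * x) + t\<rceil>"
  have b0: "real b0 \<ge> 1 / (2 * x) + t" "real b0 < 1 / (2 * x) + t + 1"
  proof -
    have "0 \<le> 1 / (2 * x) + t" using x t by simp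
    then have "real b0 = of_int \<lceil>1 / (2 * x) + t\<rceil>" by (simp add: b0_def)
    then show "real b0 \<ge> 1 / (2 * x) + t" "real b0 < 1 / (2 * x) + t + 1" by linarith+
  qed
  have u0: "0 \<le> u b0 - 1 / 2" "u b0 - 1 / 2 \<le> x"
  proof -
    have e: "u b0 - 1 / 2 = x * (real b0 - t - 1 / (2 * x))" using x by (simp add: u_def field_simps)
    then show "0 \<le> u b0 - 1 / 2" using b0 x by simp
    have "x * (real b0 - t - 1 / (2 * x)) \<le> x * 1" using b0 x by (intro mult_left_mono) auto
    then show "u b0 - 1 / 2 \<le> x" using e by simp
  qed
  have "4 \<le> 1 / (2 * x)" using x x1 by (simp add: field_simps)
  then have "real b0 < real a + 1" using b0 a t gauss_map_bounds[of x] by (simp add: field_simps)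
  then have "b0 < n" using n by simp
  then have b0C: "b0 \<in> C" using u0 x by (simp add: C_def)
  have wE: "w \<ge> E b0" unfolding w_def using b0C fC E by (intro member_le_sum) (auto intro: less_imp_le)
  have w: "w > 0" using wE E[of b0] by linarith
  have E0: "exp (\<bar>s\<bar> * ((1 / 4 - x\<^sup>2) / (2 * x) - 1 / 2)) \<le> E b0"
  proof -
    have "(u b0 - 1 / 2)\<^sup>2 \<le> x\<^sup>2" using u0 by (intro power_mono) auto
    then have "(1 / 4 - x\<^sup>2) / (2 * x) \<le> (1 / 4 - (u b0 - 1 / 2)\<^sup>2) / (2 * x)"
      using x by (intro divide_right_mono) auto
    moreover have "u b0 \<le> 1" using u0 x1 by linarith
    ultimately show ?thesis unfolding E_eq by (simp add: mult_left_mono)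
  qed
  have tail: "E b \<le> exp (\<bar>s\<bar> * (1 - (d\<^sup>2 - x\<^sup>2) / (2 * x))) * w" if b: "b < n" "b \<notin> C" for b
  proof -
    have "\<bar>u b - 1 / 2\<bar> \<ge> d" using b by (auto simp: C_def)
    then have "\<bar>d\<bar> \<le> \<bar>u b - 1 / 2\<bar>" using x by linarith
    then have "d\<^sup>2 \<le> (u b - 1 / 2)\<^sup>2" by (simp only: abs_le_square_iff)
    then have "(1 / 4 - (u b - 1 / 2)\<^sup>2) / (2 * x) \<le> (1 / 4 - d\<^sup>2) / (2 * x)"
      using x by (intro divide_right_mono) auto
    moreover have "- 1 \<le> u b" using Dom_abs_le[OF x(1) x1(1) dom[OF b(1)]] by linarith
    ultimately have "E b \<le> exp (\<bar>s\<bar> * ((1 / 4 - d\<^sup>2) / (2 * x) + 1 / 2))"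
      unfolding E_eq by (simp add: mult_left_mono)
    also have "\<dots> = exp (\<bar>s\<bar> * (1 - (d\<^sup>2 - x\<^sup>2) / (2 * x))) * exp (\<bar>s\<bar> * ((1 / 4 - x\<^sup>2) / (2 * x) - 1 / 2))"
      by (simp add: exp_add[symmetric] algebra_simps diff_divide_distrib)
    also have "\<dots> \<le> exp (\<bar>s\<bar> * (1 - (d\<^sup>2 - x\<^sup>2) / (2 * x))) * w"
      using E0 wE by (intro mult_left_mono) auto
    finally show ?thesis .
  qed
  have tails: "sum E ({..<n} - C) \<le> conc_err s d x * w"
  proof -
    have "sum E ({..<n} - C) \<le> real (card ({..<n} - C)) * (exp (\<bar>s\<bar> * (1 - (d\<^sup>2 - x\<^sup>2) / (2 * x))) * w)"
      using tail by (intro sum_bounded_above) auto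
    also have "\<dots> \<le> (1 / x + 2) * (exp (\<bar>s\<bar> * (1 - (d\<^sup>2 - x\<^sup>2) / (2 * x))) * w)"
    proof (rule mult_right_mono)
      have "card ({..<n} - C) \<le> card {..<n}" by (intro card_mono) auto
      then show "real (card ({..<n} - C)) \<le> 1 / x + 2" using n by simp
    qed (use w in simp)
    finally show ?thesis by (simp add: conc_err_def mult.assoc)
  qed
  show ?thesis
  proof (rule that[OF w])
    fix g :: "bool \<Rightarrow> real \<Rightarrow> real" and \<Gamma> k l :: real
    assume \<Gamma>: "\<Gamma> \<ge> 0"
      and near: "\<And>u. \<bar>u - 1 / 2\<bar> \<le> d \<Longrightarrow> exp (- k) * \<Gamma> \<le> g False u \<and> g False u \<le> exp k * \<Gamma>"
      and far: "\<And>st u. u \<in> Dom st x \<Longrightarrow> 0 \<le> g st u \<and> g st u \<le> exp l * \<Gamma>"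
    have F: "fibre False (gauss_map x) (nxt s x g) t
        = (\<Sum>b\<in>C. E b * g False (u b)) + (\<Sum>b\<in>{..<n} - C. E b * g (b = n - 1) (u b))"
    proof -
      \<comment> \<open>Displacements in state \<open>True\<close> are at least
        \<open>1 - x\<close>, far from \<open>1 / 2\<close>, so the central digits see only state
        \<open>False\<close>.\<close>
      have st: "b \<noteq> n - 1" if "b \<in> C" for b
      proof
        assume "b = n - 1"
        then have "u b \<in> Dom True x" using dom[of b] that by (simp add: C_def)
        then show False using that x1 d by (auto simp: C_def Dom_def)
      qed
      have "fibre False (gauss_map x) (nxt s x g) t = (\<Sum>b<n. E b * g (b = n - 1) (u b))"
        unfolding fibre_nxt_eq n_def[symmetric] by (simp add: wt_def E_def u_def)
      also have "\<dots> = (\<Sum>b\<in>{..<n} - C. E b * g (b = n - 1) (u b)) + (\<Sum>b\<in>C. E b * g (b = n - 1) (u b))"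
        by (rule sum.subset_diff) (auto simp: C_def)
      also have "(\<Sum>b\<in>C. E b * g (b = n - 1) (u b)) = (\<Sum>b\<in>C. E b * g False (u b))"
        using st by (intro sum.cong) auto
      finally show ?thesis by simp
    qed
    have 1: "exp (- k) * \<Gamma> * w \<le> (\<Sum>b\<in>C. E b * g False (u b))"
      unfolding w_def sum_distrib_left
    proof (rule sum_mono)
      fix b assume "b \<in> C"
      then have "exp (- k) * \<Gamma> \<le> g False (u b)" using near by (simp add: C_def)
      from mult_left_mono[OF this less_imp_le[OF E[of b]]]
      show "exp (- k) * \<Gamma> * E b \<le> E b * g False (u b)" by (simp add: mult_ac)
    qed
    have 2: "(\<Sum>b\<in>C. E b * g False (u b)) \<le> exp k * \<Gamma> * w"
      unfolding w_def sum_distrib_left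
    proof (rule sum_mono)
      fix b assume "b \<in> C"
      then have "g False (u b) \<le> exp k * \<Gamma>" using near by (simp add: C_def)
      from mult_left_mono[OF this less_imp_le[OF E[of b]]]
      show "E b * g False (u b) \<le> exp k * \<Gamma> * E b" by (simp add: mult_ac)
    qed
    have 3: "0 \<le> (\<Sum>b\<in>{..<n} - C. E b * g (b = n - 1) (u b))"
      using far dom E by (intro sum_nonneg mult_nonneg_nonneg) (auto intro: less_imp_le)
    have "(\<Sum>b\<in>{..<n} - C. E b * g (b = n - 1) (u b)) \<le> (\<Sum>b\<in>{..<n} - C. (exp l * \<Gamma>) * E b)"
    proof (rule sum_mono)
      fix b assume "b \<in> {..<n} - C"
      then have "g (b = n - 1) (u b) \<le> exp l * \<Gamma>" using far dom by auto
      from mult_left_mono[OF this less_imp_le[OF E[of b]]]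
      show "E b * g (b = n - 1) (u b) \<le> exp l * \<Gamma> * E b" by (simp add: mult_ac)
    qed
    also have "\<dots> \<le> exp l * \<Gamma> * (conc_err s d x * w)"
      unfolding sum_distrib_left[symmetric] using tails \<Gamma> by (intro mult_left_mono) auto
    finally have 4: "(\<Sum>b\<in>{..<n} - C. E b * g (b = n - 1) (u b)) \<le> exp l * \<Gamma> * (conc_err s d x * w)" .
    show "exp (- k) * \<Gamma> * w \<le> fibre False (gauss_map x) (nxt s x g) t \<and>
      fibre False (gauss_map x) (nxt s x g) t \<le> (exp k + conc_err s d x * exp l) * \<Gamma> * w"
      unfolding F using 1 2 3 4 by (simp add: algebra_simps)
  qed
qed

text \<open>The common \<open>w\<close> drops out of the quotient, and only the central values
  \<open>\<Gamma>\<close> and \<open>\<Gamma>'\<close> remain.\<close>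

lemma fibre_compare:
  assumes x: "0 < x" "x \<le> d / 2" and d: "d < 1 / 4" and s: "s < 0" and t: "0 \<le> t" "t < 1"
    and \<Gamma>: "\<Gamma> > 0" "\<Gamma>' > 0"
    and near: "\<And>u. \<bar>u - 1 / 2\<bar> \<le> d \<Longrightarrow> exp (- k) * \<Gamma> \<le> g False u \<and> g False u \<le> exp k * \<Gamma>"
      "\<And>u. \<bar>u - 1 / 2\<bar> \<le> d \<Longrightarrow> exp (- k) * \<Gamma>' \<le> g' False u \<and> g' False u \<le> exp k * \<Gamma>'"
    and far: "\<And>st u. u \<in> Dom st x \<Longrightarrow> 0 \<le> g st u \<and> g st u \<le> exp l * \<Gamma>"
      "\<And>st u. u \<in> Dom st x \<Longrightarrow> 0 \<le> g' st u \<and> g' st u \<le> exp l * \<Gamma>'"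
  shows "fibre False (gauss_map x) (nxt s x g) t
      \<le> (exp k + conc_err s d x * exp l) * exp k * (\<Gamma> / \<Gamma>') * fibre False (gauss_map x) (nxt s x g') t"
    and "0 < fibre False (gauss_map x) (nxt s x g') t"
proof -
  obtain w where w: "w > 0"
    "\<And>g \<Gamma> k l. \<Gamma> \<ge> 0 \<Longrightarrow>
      (\<And>u. \<bar>u - 1 / 2\<bar> \<le> d \<Longrightarrow> exp (- k) * \<Gamma> \<le> g False u \<and> g False u \<le> exp k * \<Gamma>) \<Longrightarrow>
      (\<And>st u. u \<in> Dom st x \<Longrightarrow> 0 \<le> g st u \<and> g st u \<le> exp l * \<Gamma>) \<Longrightarrow>
      exp (- k) * \<Gamma> * w \<le> fibre False (gauss_map x) (nxt s x g) t \<and>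
      fibre False (gauss_map x) (nxt s x g) t \<le> (exp k + conc_err s d x * exp l) * \<Gamma> * w"
    using fibre_concentration[OF x d s t] by metis
  define F where "F = fibre False (gauss_map x) (nxt s x g) t"
  define F' where "F' = fibre False (gauss_map x) (nxt s x g') t"
  define \<kappa> where "\<kappa> = exp k + conc_err s d x * exp l"
  have "\<kappa> > 0" using x by (auto simp: \<kappa>_def conc_err_def intro!: add_pos_nonneg)
  have 1: "F \<le> \<kappa> * \<Gamma> * w"
    using w(2)[of \<Gamma> k g l] near far \<Gamma> by (auto simp: F_def \<kappa>_def)
  have 2: "exp (- k) * \<Gamma>' * w \<le> F'"
    using w(2)[of \<Gamma>' k g' l] near far \<Gamma> by (auto simp: F'_def)
  have "0 < exp (- k) * \<Gamma>' * w" using w \<Gamma> by simp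
  then show "0 < fibre False (gauss_map x) (nxt s x g') t" using 2 by (simp add: F'_def)
  have "\<kappa> * \<Gamma> * w = \<kappa> * exp k * (\<Gamma> / \<Gamma>') * (exp (- k) * \<Gamma>' * w)"
    using \<Gamma> by (simp add: field_simps exp_minus)
  also have "\<dots> \<le> \<kappa> * exp k * (\<Gamma> / \<Gamma>') * F'"
    using 2 \<open>\<kappa> > 0\<close> \<Gamma> by (intro mult_left_mono) auto
  finally show "fibre False (gauss_map x) (nxt s x g) t
      \<le> (exp k + conc_err s d x * exp l) * exp k * (\<Gamma> / \<Gamma>') * fibre False (gauss_map x) (nxt s x g') t"
    using 1 by (simp add: F_def F'_def \<kappa>_def)
qed

section \<open>Comparison of the sums for a rational and its second iterate\<close>

lemma reduced_denom_pos: "x \<in> \<rat> \<Longrightarrow> 0 < reduced_denom x"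
  using is_den_reduced_denom[of x] by (simp add: is_den_def)

text \<open>For \<open>p \<noteq> 0\<close>, the \<open>p\<close>-th power of
  \<open>J (ereal p) r\<close>.\<close>

definition bsum :: "real \<Rightarrow> real \<Rightarrow> real" where
  "bsum p r = (\<Sum>N<reduced_denom r. exp (p * S N r))"

lemma bsum_pos: "r \<in> \<rat> \<Longrightarrow> 0 < bsum p r"
  unfolding bsum_def using reduced_denom_pos[of r] by (intro sum_pos) auto

text \<open>Taking \<open>c = odd K\<close> in \<open>birkhoff_sum_eq_fsum\<close> makes the flag at
  depth \<open>K\<close> equal to \<open>False\<close>, which removes the virtual summand.\<close>

lemma bsum_eq_fibre_sum:
  assumes "r \<in> \<rat>" "\<And>i. i \<le> K \<Longrightarrow> (gauss_map ^^ i) r \<in> {0<..<1}"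
  defines "z \<equiv> (gauss_map ^^ K) r"
  shows "bsum p r = (\<Sum>N<reduced_denom z. exp ((- 1) ^ K * p * S N z) * fibre False z (Phi p r K) (frac (real N * z)))"
  using birkhoff_sum_eq_fsum[OF assms(1,2), of K p "odd K"] by (simp add: bsum_def fsum_def z_def)

text \<open>Supplies the hypotheses of \<open>fibre_compare\<close> with central value
  \<open>Phi p x K False (1 / 2)\<close>. The bounds \<open>1 / 8\<close> and \<open>1 / 4\<close>
  keep the \<open>d\<close>-neighbourhood of \<open>1 / 2\<close> inside the domain of state
  \<open>False\<close>.\<close>

lemma Phi_near_far:
  assumes K: "\<And>i. i < K \<Longrightarrow> (gauss_map ^^ i) x \<in> {0<..<1}"
    and z: "0 < (gauss_map ^^ K) x" "(gauss_map ^^ K) x \<le> 1 / 8" and d: "d < 1 / 4"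
  shows "\<bar>u - 1 / 2\<bar> \<le> d \<Longrightarrow> exp (- (8 * \<bar>p\<bar> * d)) * Phi p x K False (1 / 2) \<le> Phi p x K False u
      \<and> Phi p x K False u \<le> exp (8 * \<bar>p\<bar> * d) * Phi p x K False (1 / 2)"
    and "u \<in> Dom st ((gauss_map ^^ K) x) \<Longrightarrow>
      0 \<le> Phi p x K st u \<and> Phi p x K st u \<le> exp (16 * \<bar>p\<bar>) * Phi p x K False (1 / 2)"
    and "0 < Phi p x K False (1 / 2)"
proof -
  have h: "1 / 2 \<in> Dom False ((gauss_map ^^ K) x)" using z by (simp add: Dom_def)
  show pos: "0 < Phi p x K False (1 / 2)" by (rule Phi_bounds(4)[OF K h])
  show "0 \<le> Phi p x K st u \<and> Phi p x K st u \<le> exp (16 * \<bar>p\<bar>) * Phi p x K False (1 / 2)"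
    if "u \<in> Dom st ((gauss_map ^^ K) x)"
    using Phi_bounds(1,3)[OF K h that] by simp
  assume u: "\<bar>u - 1 / 2\<bar> \<le> d"
  then have uD: "u \<in> Dom False ((gauss_map ^^ K) x)" using z d by (auto simp: Dom_def abs_le_iff)
  have "8 * \<bar>p\<bar> * \<bar>u - 1 / 2\<bar> \<le> 8 * \<bar>p\<bar> * d" using u by (intro mult_left_mono) auto
  then have e: "exp (8 * \<bar>p\<bar> * \<bar>u - 1 / 2\<bar>) \<le> exp (8 * \<bar>p\<bar> * d)" by simp
  have "Phi p x K False u \<le> exp (8 * \<bar>p\<bar> * \<bar>u - 1 / 2\<bar>) * Phi p x K False (1 / 2)"
    by (rule Phi_bounds(2)[OF K h uD])
  also have "\<dots> \<le> exp (8 * \<bar>p\<bar> * d) * Phi p x K False (1 / 2)"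
    using e pos by (intro mult_right_mono) auto
  finally have 1: "Phi p x K False u \<le> exp (8 * \<bar>p\<bar> * d) * Phi p x K False (1 / 2)" .
  have "Phi p x K False (1 / 2) \<le> exp (8 * \<bar>p\<bar> * \<bar>1 / 2 - u\<bar>) * Phi p x K False u"
    by (rule Phi_bounds(2)[OF K uD h])
  also have "\<dots> \<le> exp (8 * \<bar>p\<bar> * d) * Phi p x K False u"
    using e Phi_bounds(1)[OF K h uD] by (intro mult_right_mono) (auto simp: abs_minus_commute)
  finally have "exp (- (8 * \<bar>p\<bar> * d)) * Phi p x K False (1 / 2) \<le> Phi p x K False u"
    by (simp add: exp_minus field_simps)
  with 1 show "exp (- (8 * \<bar>p\<bar> * d)) * Phi p x K False (1 / 2) \<le> Phi p x K False u
      \<and> Phi p x K False u \<le> exp (8 * \<bar>p\<bar> * d) * Phi p x K False (1 / 2)" by simp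
qed

text \<open>If \<open>r\<close> and \<open>r'\<close> reach the same iterate \<open>x\<close> at
  depths of equal parity, then one step after \<open>x\<close> both sums run over the same indices
  with the same factors \<open>exp (- s * S N y)\<close>. Only the fibres differ, and
  \<open>fibre_compare\<close> treats them term by term.\<close>

lemma ln_bsum_le:
  assumes r: "r \<in> \<rat>" "r' \<in> \<rat>"
    and K: "\<And>i. i \<le> Suc K \<Longrightarrow> (gauss_map ^^ i) r \<in> {0<..<1}"
      "\<And>i. i \<le> Suc K' \<Longrightarrow> (gauss_map ^^ i) r' \<in> {0<..<1}"
    and eq: "(gauss_map ^^ K) r = x" "(gauss_map ^^ K') r' = x" "even K' = even K"
    and x: "x \<le> d / 2" and d: "d < 1 / 4" and s: "(- 1) ^ K * p < 0"
  shows "ln (bsum p r) \<le> ln (bsum p r') + (ln (Phi p r K False (1 / 2)) - ln (Phi p r' K' False (1 / 2)))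
    + 16 * \<bar>p\<bar> * d + conc_err p d x * exp (16 * \<bar>p\<bar>)"
proof -
  define s where "s = (- 1) ^ K * p"
  define y where "y = gauss_map x"
  define k where "k = 8 * \<bar>p\<bar> * d"
  define \<eta> where "\<eta> = conc_err p d x * exp (16 * \<bar>p\<bar>)"
  define \<Gamma> where "\<Gamma> = Phi p r K False (1 / 2)"
  define \<Gamma>' where "\<Gamma>' = Phi p r' K' False (1 / 2)"
  have x0: "0 < x" "x \<le> 1 / 8" using K(1)[of K] eq x d by auto
  have s': "(- 1) ^ K' * p = s" using eq(3) by (cases "even K") (simp_all add: s_def)
  have e: "(- 1) ^ Suc K * p = - s" "(- 1) ^ Suc K' * p = - s" using s' by (simp_all add: s_def)
  have sc: "conc_err s d x = conc_err p d x" by (simp add: conc_err_def s_def abs_mult)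
  have P0: "(gauss_map ^^ i) r \<in> {0<..<1}" if "i < K" for i using K(1) that by simp
  have Pz: "0 < (gauss_map ^^ K) r" "(gauss_map ^^ K) r \<le> 1 / 8" using x0 by (simp_all only: eq)
  have P1: "exp (- k) * \<Gamma> \<le> Phi p r K False u \<and> Phi p r K False u \<le> exp k * \<Gamma>"
    if "\<bar>u - 1 / 2\<bar> \<le> d" for u
    unfolding k_def \<Gamma>_def by (rule Phi_near_far(1)[OF P0 Pz d that])
  have P2: "0 \<le> Phi p r K st u \<and> Phi p r K st u \<le> exp (16 * \<bar>p\<bar>) * \<Gamma>" if "u \<in> Dom st x" for st u
    unfolding \<Gamma>_def by (rule Phi_near_far(2)[OF P0 Pz d]) (simp_all only: eq that)
  have P3: "0 < \<Gamma>"
    unfolding \<Gamma>_def by (rule Phi_near_far(3)[OF P0 Pz d])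
  have Q0: "(gauss_map ^^ i) r' \<in> {0<..<1}" if "i < K'" for i using K(2) that by simp
  have Qz: "0 < (gauss_map ^^ K') r'" "(gauss_map ^^ K') r' \<le> 1 / 8" using x0 by (simp_all only: eq)
  have Q1: "exp (- k) * \<Gamma>' \<le> Phi p r' K' False u \<and> Phi p r' K' False u \<le> exp k * \<Gamma>'"
    if "\<bar>u - 1 / 2\<bar> \<le> d" for u
    unfolding k_def \<Gamma>'_def by (rule Phi_near_far(1)[OF Q0 Qz d that])
  have Q2: "0 \<le> Phi p r' K' st u \<and> Phi p r' K' st u \<le> exp (16 * \<bar>p\<bar>) * \<Gamma>'" if "u \<in> Dom st x" for st u
    unfolding \<Gamma>'_def by (rule Phi_near_far(2)[OF Q0 Qz d]) (simp_all only: eq that)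
  have Q3: "0 < \<Gamma>'"
    unfolding \<Gamma>'_def by (rule Phi_near_far(3)[OF Q0 Qz d])
  define c where "c = (exp k + \<eta>) * exp k * (\<Gamma> / \<Gamma>')"
  have F: "fibre False y (nxt s x (Phi p r K)) t \<le> c * fibre False y (nxt s x (Phi p r' K')) t"
    if "0 \<le> t" "t < 1" for t
    unfolding y_def c_def \<eta>_def sc[symmetric]
    by (rule fibre_compare(1)[where g = "Phi p r K" and g' = "Phi p r' K'" and k = k and l = "16 * \<bar>p\<bar>",
        OF x0(1) x d s[folded s_def] that P3 Q3 P1 Q1 P2 Q2])
  have "bsum p r = (\<Sum>N<reduced_denom y. exp (- s * S N y) * fibre False y (nxt s x (Phi p r K)) (frac (real N * y)))"
    using bsum_eq_fibre_sum[OF r(1) K(1), of "Suc K" p]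
    by (simp only: e Phi.simps funpow.simps o_apply eq(1) order.refl flip: y_def s_def)
  also have "\<dots> \<le> (\<Sum>N<reduced_denom y. c * (exp (- s * S N y) * fibre False y (nxt s x (Phi p r' K')) (frac (real N * y))))"
  proof (rule sum_mono)
    fix N
    show "exp (- s * S N y) * fibre False y (nxt s x (Phi p r K)) (frac (real N * y))
      \<le> c * (exp (- s * S N y) * fibre False y (nxt s x (Phi p r' K')) (frac (real N * y)))"
      using mult_left_mono[OF F[of "frac (real N * y)"], of "exp (- s * S N y)"] by (simp add: mult_ac frac_lt_1)
  qed
  also have "\<dots> = c * bsum p r'"
    using bsum_eq_fibre_sum[OF r(2) K(2), of "Suc K'" p]
    by (simp only: e Phi.simps funpow.simps o_apply eq(2) s' order.refl flip: y_def sum_distrib_left)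
  finally have le: "bsum p r \<le> c * bsum p r'" .
  have \<eta>: "\<eta> \<ge> 0" using x0 by (auto simp: \<eta>_def conc_err_def)
  then have ek: "exp k + \<eta> > 0" by (simp add: add_pos_nonneg)
  then have "c > 0" using P3 Q3 by (simp add: c_def)
  have "ln (bsum p r) \<le> ln (c * bsum p r')"
    using le bsum_pos[OF r(1), of p] bsum_pos[OF r(2), of p] \<open>c > 0\<close> by (subst ln_le_cancel_iff) auto
  also have "\<dots> = ln c + ln (bsum p r')"
    using bsum_pos[OF r(2), of p] \<open>c > 0\<close> by (simp add: ln_mult)
  also have "ln c = ln (exp k + \<eta>) + k + (ln \<Gamma> - ln \<Gamma>')"
    unfolding c_def using ek P3 Q3 by (simp add: ln_mult ln_div)
  also have "ln (exp k + \<eta>) \<le> k + \<eta>"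
  proof -
    have "1 \<le> exp k" using x x0 by (simp add: k_def)
    then have "\<eta> * 1 \<le> \<eta> * exp k" using \<eta> by (intro mult_left_mono) auto
    then have "exp k + \<eta> \<le> exp k * (1 + \<eta>)" by (simp add: algebra_simps)
    then have "ln (exp k + \<eta>) \<le> ln (exp k * (1 + \<eta>))" using ek \<eta> by (subst ln_le_cancel_iff) auto
    also have "\<dots> = k + ln (1 + \<eta>)" using \<eta> by (simp add: ln_mult)
    finally show ?thesis using ln_add_one_self_le_self[OF \<eta>] by linarith
  qed
  finally show ?thesis by (simp add: \<Gamma>_def \<Gamma>'_def k_def \<eta>_def algebra_simps)
qed

text \<open>The second iterate of \<open>r\<close> reaches \<open>(gauss_map ^^ K) r\<close> two
  steps earlier, hence with the same parity, so the comparison applies in both directions.\<close>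

lemma ln_bsum_ratio:
  assumes r: "r \<in> \<rat>" and K: "\<And>i. i \<le> Suc K \<Longrightarrow> (gauss_map ^^ i) r \<in> {0<..<1}" "K \<ge> 2"
    and x: "(gauss_map ^^ K) r \<le> d / 2" and d: "d < 1 / 4" and s: "(- 1) ^ K * p < 0"
  defines "r' \<equiv> (gauss_map ^^ 2) r"
  shows "\<bar>ln (bsum p r) - ln (bsum p r') - (ln (Phi p r K False (1 / 2)) - ln (Phi p r' (K - 2) False (1 / 2)))\<bar>
    \<le> 16 * \<bar>p\<bar> * d + conc_err p d ((gauss_map ^^ K) r) * exp (16 * \<bar>p\<bar>)"
proof -
  have it: "(gauss_map ^^ i) r' = (gauss_map ^^ (i + 2)) r" for i
    unfolding r'_def by (simp only: funpow_add o_apply)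
  have r': "r' \<in> \<rat>" using gauss_map_funpow_rat[OF r] by (simp add: r'_def)
  have K': "(gauss_map ^^ i) r' \<in> {0<..<1}" if "i \<le> Suc (K - 2)" for i
    unfolding it using K(2) that by (intro K(1)) simp
  have e: "(gauss_map ^^ (K - 2)) r' = (gauss_map ^^ K) r" using K(2) by (simp only: it le_add_diff_inverse2)
  have ev: "even (K - 2) = even K" using K(2) by simp
  have s': "(- 1) ^ (K - 2) * p < 0" using s ev by (simp only: minus_one_power_iff)
  show ?thesis
    using ln_bsum_le[OF r r' K(1) K' refl e ev x d s] ln_bsum_le[OF r' r K' K(1) e refl ev[symmetric] x d s']
    by (simp add: abs_le_iff)
qed

section \<open>The limit\<close>

lemma gauss_map_tendsto:
  assumes X: "(X \<longlongrightarrow> x) F" and x: "x \<in> {0<..<1} - \<rat>"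
  shows "((\<lambda>n. gauss_map (X n)) \<longlongrightarrow> gauss_map x) F"
    and "\<forall>\<^sub>F n in F. \<lfloor>1 / X n\<rfloor> = \<lfloor>1 / x\<rfloor>"
proof -
  have x0: "x > 0" using x by auto
  have lim: "((\<lambda>n. 1 / X n) \<longlongrightarrow> 1 / x) F"
    using x0 by (intro tendsto_divide tendsto_const X) auto
  \<comment> \<open>Irrationality keeps \<open>1 / x\<close> away from the jumps of the floor
    function.\<close>
  have nint: "1 / x \<notin> \<int>"
  proof
    assume "1 / x \<in> \<int>"
    then have "1 / x \<in> \<rat>" using Ints_subset_Rats by blast
    then have "1 / (1 / x) \<in> \<rat>" by (rule Rats_divide[OF Rats_1])
    then show False using x by simp
  qed
  show fl: "\<forall>\<^sub>F n in F. \<lfloor>1 / X n\<rfloor> = \<lfloor>1 / x\<rfloor>"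
    by (rule eventually_floor_eq[OF lim nint])
  have "((\<lambda>n. 1 / X n - of_int \<lfloor>1 / x\<rfloor>) \<longlongrightarrow> 1 / x - of_int \<lfloor>1 / x\<rfloor>) F"
    by (intro tendsto_diff lim tendsto_const)
  moreover have "\<forall>\<^sub>F n in F. 1 / X n - of_int \<lfloor>1 / x\<rfloor> = gauss_map (X n)"
    using fl order_tendstoD(1)[OF X x0] by eventually_elim (simp add: gauss_map_def frac_def)
  ultimately have "((\<lambda>n. gauss_map (X n)) \<longlongrightarrow> 1 / x - of_int \<lfloor>1 / x\<rfloor>) F"
    by (rule Lim_transform_eventually)
  then show "((\<lambda>n. gauss_map (X n)) \<longlongrightarrow> gauss_map x) F"
    using x0 by (simp add: gauss_map_def frac_def)
qed

lemma gauss_map_funpow_irrational: "x \<in> {0<..<1} - \<rat> \<Longrightarrow> (gauss_map ^^ K) x \<in> {0<..<1} - \<rat>"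
proof (induction K)
  case (Suc K)
  show ?case unfolding funpow.simps o_apply by (rule gauss_map_irrational[OF Suc.IH[OF Suc.prems]])
qed simp

lemma gauss_map_funpow_tendsto:
  assumes "(X \<longlongrightarrow> x) F" "x \<in> {0<..<1} - \<rat>"
  shows "((\<lambda>n. (gauss_map ^^ K) (X n)) \<longlongrightarrow> (gauss_map ^^ K) x) F"
proof (induction K)
  case (Suc K)
  show ?case
    using gauss_map_tendsto(1)[OF Suc.IH gauss_map_funpow_irrational[OF assms(2)]] by simp
qed (simp add: assms)

text \<open>Logarithms at distance at most \<open>e\<close>, stated without logarithms because
  \<open>Phi\<close> vanishes in state \<open>True\<close> at depth 0; in this form it passes to
  sums.\<close>

definition exp_close :: "real \<Rightarrow> real \<Rightarrow> real \<Rightarrow> bool" where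
  "exp_close e a b \<longleftrightarrow> a \<le> exp e * b \<and> b \<le> exp e * a"

lemma exp_close_add: "exp_close e a b \<Longrightarrow> exp_close e c d \<Longrightarrow> exp_close e (a + c) (b + d)"
  by (auto simp: exp_close_def distrib_left intro: add_mono)

lemma exp_close_sum: "(\<And>i. i \<in> I \<Longrightarrow> exp_close e (f i) (g i)) \<Longrightarrow> exp_close e (sum f I) (sum g I)"
  by (auto simp: exp_close_def sum_distrib_left intro!: sum_mono)

lemma exp_close_ln:
  assumes "exp_close e a b" "0 < a" "0 < b"
  shows "\<bar>ln a - ln b\<bar> \<le> e"
proof -
  have "ln a \<le> ln (exp e * b)" "ln b \<le> ln (exp e * a)"
    using assms by (auto simp: exp_close_def)
  then show ?thesis using assms by (simp add: ln_mult abs_le_iff)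
qed

lemma exp_close_wt:
  assumes "\<bar>cell x u - cell y v\<bar> \<le> e" "exp_close (\<bar>s\<bar> * e) (g st u) (g' st v)" "0 \<le> g st u" "0 \<le> g' st v"
  shows "exp_close (\<bar>s\<bar> * (2 * e)) (wt s x g st u) (wt s y g' st v)"
proof -
  have *: "exp (s * c) * a \<le> exp (\<bar>s\<bar> * (2 * e)) * (exp (s * d) * b)"
    if "\<bar>c - d\<bar> \<le> e" "a \<le> exp (\<bar>s\<bar> * e) * b" "0 \<le> a" for a b c d
  proof -
    have "s * (c - d) \<le> \<bar>s\<bar> * \<bar>c - d\<bar>" by (metis abs_ge_self abs_mult)
    also have "\<dots> \<le> \<bar>s\<bar> * e" using that by (intro mult_left_mono) auto
    finally have "s * c \<le> \<bar>s\<bar> * e + s * d" by (simp add: right_diff_distrib)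
    then have "exp (s * c) * a \<le> exp (\<bar>s\<bar> * e + s * d) * (exp (\<bar>s\<bar> * e) * b)"
      using that by (intro mult_mono) auto
    also have "\<dots> = exp (\<bar>s\<bar> * (2 * e)) * (exp (s * d) * b)"
      by (simp add: mult.assoc distrib_left flip: exp_add)
    finally show ?thesis .
  qed
  show ?thesis unfolding exp_close_def wt_def
    using assms by (intro conjI *) (auto simp: exp_close_def abs_minus_commute)
qed

lemma Phi_nonneg: "0 \<le> Phi p x K st t"
  by (induction K arbitrary: st t) (auto simp: nxt_def wt_def intro!: add_nonneg_nonneg sum_nonneg)

lemma cell_tendsto:
  assumes "(X \<longlongrightarrow> x) F" "(U \<longlongrightarrow> u) F" "x \<noteq> 0"
  shows "((\<lambda>n. cell (X n) (U n)) \<longlongrightarrow> cell x u) F"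
  unfolding cell_def using assms by (auto intro!: tendsto_intros)

text \<open>Near an irrational the digit ranges are eventually constant, so \<open>Phi\<close> is a
  fixed finite expression in continuous quantities. As \<open>p\<close> enters only through
  exponents, a tolerance proportional to \<open>\<bar>p\<bar>\<close> makes the neighbourhood
  independent of \<open>p\<close>. The argument \<open>T\<close> varies because the recursion
  evaluates at moving displacements.\<close>

lemma Phi_exp_close:
  assumes X: "(X \<longlongrightarrow> x) F" and x: "x \<in> {0<..<1} - \<rat>"
    and "(T \<longlongrightarrow> t) F" "e > 0"
  shows "\<forall>\<^sub>F n in F. \<forall>p. exp_close (\<bar>p\<bar> * e) (Phi p (X n) K st (T n)) (Phi p x K st t)"
  using assms(3,4)
proof (induction K arbitrary: st T t e)
  case 0
  then show ?case by (auto simp: exp_close_def)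
next
  case (Suc K)
  define Y where "Y n = (gauss_map ^^ K) (X n)" for n
  define y where "y = (gauss_map ^^ K) x"
  have Y: "(Y \<longlongrightarrow> y) F" unfolding Y_def y_def by (rule gauss_map_funpow_tendsto[OF X x])
  have y: "y \<in> {0<..<1} - \<rat>" unfolding y_def by (rule gauss_map_funpow_irrational[OF x])
  then have y0: "y \<noteq> 0" by auto
  have W: "\<forall>\<^sub>F n in F. \<forall>p. exp_close (\<bar>p\<bar> * e) (wt ((- 1) ^ K * p) (Y n) (Phi p (X n) K) st (Y n * (b - T n)))
      (wt ((- 1) ^ K * p) y (Phi p x K) st (y * (b - t)))" for st b
  proof -
    have U: "((\<lambda>n. Y n * (b - T n)) \<longlongrightarrow> y * (b - t)) F"
      by (intro tendsto_intros Y Suc.prems)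
    \<comment> \<open>Half of the tolerance goes to the factor with \<open>cell\<close>, half to the
      weight.\<close>
    have e2: "e / 2 > 0" using Suc.prems by simp
    have "\<forall>\<^sub>F n in F. dist (cell (Y n) (Y n * (b - T n))) (cell y (y * (b - t))) < e / 2"
      by (rule tendstoD[OF cell_tendsto[OF Y U y0] e2])
    with Suc.IH[OF U e2, of st] show ?thesis
    proof eventually_elim
      case (elim n)
      show ?case
      proof
        fix p
        have "exp_close (\<bar>(- 1) ^ K * p\<bar> * (2 * (e / 2))) (wt ((- 1) ^ K * p) (Y n) (Phi p (X n) K) st (Y n * (b - T n)))
          (wt ((- 1) ^ K * p) y (Phi p x K) st (y * (b - t)))"
          by (rule exp_close_wt) (use elim Phi_nonneg in \<open>auto simp: dist_real_def abs_mult\<close>)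
        then show "exp_close (\<bar>p\<bar> * e) (wt ((- 1) ^ K * p) (Y n) (Phi p (X n) K) st (Y n * (b - T n)))
          (wt ((- 1) ^ K * p) y (Phi p x K) st (y * (b - t)))" by (simp add: abs_mult)
      qed
    qed
  qed
  show ?case
  proof (cases st)
    case True
    show ?thesis using W[of False 0] True by (simp add: nxt_def flip: Y_def y_def)
  next
    case False
    define a where "a = nat \<lfloor>1 / y\<rfloor>"
    have "\<forall>\<^sub>F n in F. \<forall>b\<in>{..<a}. \<forall>p. exp_close (\<bar>p\<bar> * e) (wt ((- 1) ^ K * p) (Y n) (Phi p (X n) K) False (Y n * (real b - T n)))
      (wt ((- 1) ^ K * p) y (Phi p x K) False (y * (real b - t)))"
      by (rule eventually_ball_finite) (auto intro: W)
    with W[of True "real a"] gauss_map_tendsto(2)[OF Y y] show ?thesis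
    proof eventually_elim
      case (elim n)
      have "nat \<lfloor>1 / Y n\<rfloor> = a" using elim by (simp add: a_def)
      show ?case
      proof
        fix p
        have "exp_close (\<bar>p\<bar> * e) (nxt ((- 1) ^ K * p) (Y n) (Phi p (X n) K) False (T n))
          (nxt ((- 1) ^ K * p) y (Phi p x K) False t)"
          unfolding nxt_def a_def[symmetric] \<open>nat \<lfloor>1 / Y n\<rfloor> = a\<close> if_False
          using elim by (intro exp_close_add exp_close_sum) blast+
        then show "exp_close (\<bar>p\<bar> * e) (Phi p (X n) (Suc K) st (T n)) (Phi p x (Suc K) st t)"
          using False by (simp flip: Y_def y_def)
      qed
    qed
  qed
qed

section \<open>Uniform estimates for finite \<open>p\<close>\<close>

lemma conc_err_small:
  assumes d: "0 < d" "d < 1" and q: "0 < q" and e: "0 < e"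
  obtains x0 where "x0 > 0"
    "\<And>p x. 0 < x \<Longrightarrow> x \<le> x0 \<Longrightarrow> q \<le> \<bar>p\<bar> \<Longrightarrow> conc_err p d x * exp (16 * \<bar>p\<bar>) \<le> \<bar>p\<bar> * e"
proof -
  define c where "c = q * d\<^sup>2 / 8"
  have c: "c > 0" using d q by (simp add: c_def)
  \<comment> \<open>The bound \<open>d / 2\<close> gives
    \<open>d\<^sup>2 - x\<^sup>2 \<ge> d\<^sup>2 / 2\<close>. Since \<open>136 = 8 * 17\<close>, the
    second lets one half of \<open>d\<^sup>2 / (4 * x)\<close> absorb \<open>1 + 16\<close>. The
    other half leaves at least \<open>c / x\<close> after multiplication by
    \<open>\<bar>p\<bar>\<close>, and with
    \<open>exp (- (c / x)) \<le> 2 * x\<^sup>2 / c\<^sup>2\<close> the third bound beats the factor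
    \<open>3 / x\<close>.\<close>
  define x0 where "x0 = min (d / 2) (min (d\<^sup>2 / 136) (q * e * c\<^sup>2 / 6))"
  have x0: "x0 > 0" using d q e c by (simp add: x0_def)
  show ?thesis
  proof (rule that[OF x0])
    fix p x :: real assume x: "0 < x" "x \<le> x0" and p: "q \<le> \<bar>p\<bar>"
    have x1: "x \<le> d / 2" "136 * x \<le> d\<^sup>2" "x \<le> q * e * c\<^sup>2 / 6" using x by (auto simp: x0_def)
    have "x\<^sup>2 \<le> (d / 2)\<^sup>2" using x x1 by (intro power_mono) auto
    then have "4 * x\<^sup>2 \<le> d\<^sup>2" by (simp add: power_divide)
    then have x2: "d\<^sup>2 / 2 \<le> d\<^sup>2 - x\<^sup>2" using zero_le_power2[of x] by linarith
    have "(d\<^sup>2 / 2) / (2 * x) \<le> (d\<^sup>2 - x\<^sup>2) / (2 * x)" using x2 x by (intro divide_right_mono) auto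
    moreover have "17 \<le> d\<^sup>2 / (8 * x)" using x1 x by (simp add: field_simps)
    moreover have "(d\<^sup>2 / 2) / (2 * x) = d\<^sup>2 / (8 * x) + d\<^sup>2 / (8 * x)" using x by (simp add: field_simps)
    ultimately have "1 - (d\<^sup>2 - x\<^sup>2) / (2 * x) + 16 \<le> - (d\<^sup>2 / (8 * x))" by linarith
    then have "\<bar>p\<bar> * (1 - (d\<^sup>2 - x\<^sup>2) / (2 * x) + 16) \<le> \<bar>p\<bar> * (- (d\<^sup>2 / (8 * x)))"
      by (intro mult_left_mono) auto
    also have "\<dots> \<le> - (q * (d\<^sup>2 / (8 * x)))" using mult_right_mono[OF p, of "d\<^sup>2 / (8 * x)"] x by simp
    also have "\<dots> = - (c / x)" using x by (simp add: c_def)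
    finally have ex: "\<bar>p\<bar> * (1 - (d\<^sup>2 - x\<^sup>2) / (2 * x)) + 16 * \<bar>p\<bar> \<le> - (c / x)"
      by (simp add: algebra_simps)
    have "(c / x)\<^sup>2 / 2 \<le> exp (c / x)" 
      using exp_lower_Taylor_quadratic[of "c / x"] c x by (smt (verit) divide_nonneg_pos)
    then have ex2: "exp (- (c / x)) \<le> 2 * x\<^sup>2 / c\<^sup>2" using c x
      by (simp add: exp_minus field_simps power_divide)
    have "conc_err p d x * exp (16 * \<bar>p\<bar>) = (1 / x + 2) * exp (\<bar>p\<bar> * (1 - (d\<^sup>2 - x\<^sup>2) / (2 * x)) + 16 * \<bar>p\<bar>)"
      by (simp add: conc_err_def exp_add)
    also have "\<dots> \<le> (3 / x) * (2 * x\<^sup>2 / c\<^sup>2)"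
    proof (rule mult_mono)
      show "1 / x + 2 \<le> 3 / x" using x x1 d by (simp add: field_simps)
      show "exp (\<bar>p\<bar> * (1 - (d\<^sup>2 - x\<^sup>2) / (2 * x)) + 16 * \<bar>p\<bar>) \<le> 2 * x\<^sup>2 / c\<^sup>2"
        using ex ex2 by (meson exp_le_cancel_iff order.trans)
    qed (use x in auto)
    also have "\<dots> = 6 * x / c\<^sup>2" using x by (simp add: power2_eq_square)
    also have "\<dots> \<le> q * e" using x1 c by (simp add: field_simps)
    also have "\<dots> \<le> \<bar>p\<bar> * e" using p e by (intro mult_right_mono) auto
    finally show "conc_err p d x * exp (16 * \<bar>p\<bar>) \<le> \<bar>p\<bar> * e" .
  qed
qed

lemma h_real:
  assumes "r \<in> \<rat>" "p \<noteq> 0"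
  shows "h (ereal p) r = (ln (bsum p r) - ln (bsum p ((gauss_map ^^ 2) r))) / p"
proof -
  have J: "J (ereal p) r = bsum p r powr (1 / p)" for r
    by (simp add: J_def bsum_def lessThan_atLeast0)
  have pos: "0 < bsum p r" "0 < bsum p ((gauss_map ^^ 2) r)"
    by (intro bsum_pos assms gauss_map_funpow_rat)+
  then have "h (ereal p) r = ln (bsum p r powr (1 / p)) - ln (bsum p ((gauss_map ^^ 2) r) powr (1 / p))"
    unfolding h_def J by (subst ln_div) auto
  also have "\<dots> = (1 / p) * ln (bsum p r) - (1 / p) * ln (bsum p ((gauss_map ^^ 2) r))"
    using pos by (simp only: ln_powr)
  finally show ?thesis by (simp add: diff_divide_distrib)
qed

text \<open>A partial quotient above \<open>1 / x\<close> at index \<open>K + 1\<close> means that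
  the \<open>K\<close>-th iterate is below \<open>x\<close>.\<close>

lemma large_partial_quotient:
  assumes \<alpha>: "\<alpha> \<in> {0<..<1} - \<rat>" and sup: "(SUP k. enat (partial_quotient \<alpha> (2 * k + e))) = \<infinity>"
    and e: "e \<ge> 1" and x: "x > 0"
  obtains K where "K \<ge> 2" "even K = even (e - 1)" "(gauss_map ^^ K) \<alpha> < x"
proof -
  \<comment> \<open>Including the quotient of index \<open>e\<close> forces
    \<open>k \<noteq> 0\<close> and hence \<open>K \<ge> 2\<close>, so that two steps can be taken
    off.\<close>
  define n where "n = max (nat \<lceil>1 / x\<rceil>) (partial_quotient \<alpha> e)"
  have "\<exists>k. n < partial_quotient \<alpha> (2 * k + e)"
  proof (rule ccontr)
    assume "\<nexists>k. n < partial_quotient \<alpha> (2 * k + e)"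
    then have "(SUP k. enat (partial_quotient \<alpha> (2 * k + e))) \<le> enat n"
      by (intro SUP_least) (simp add: not_less)
    then show False using sup by simp
  qed
  then obtain k where k: "n < partial_quotient \<alpha> (2 * k + e)" by blast
  then have "k \<noteq> 0" by (intro notI) (simp add: n_def)
  define K where "K = 2 * k + e - 1"
  have z: "0 < (gauss_map ^^ K) \<alpha>" using gauss_map_funpow_irrational[OF \<alpha>] by auto
  have "n < nat \<lfloor>1 / (gauss_map ^^ K) \<alpha>\<rfloor>" using k by (simp add: partial_quotient_def K_def)
  then have "real n < 1 / (gauss_map ^^ K) \<alpha>" by linarith
  moreover have "1 / x \<le> real n" unfolding n_def by linarith
  ultimately have "1 / x < 1 / (gauss_map ^^ K) \<alpha>" by linarith
  then have "(gauss_map ^^ K) \<alpha> < x" using x z by (simp add: field_simps)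
  moreover have "K = 2 * k + (e - 1)" using e by (simp add: K_def)
  then have "K \<ge> 2" "even K = even (e - 1)" using \<open>k \<noteq> 0\<close> by auto
  ultimately show ?thesis using that by blast
qed

abbreviation (input) rat_at :: "real \<Rightarrow> real filter" where
  "rat_at x \<equiv> at x within {0..<1} \<inter> \<rat>"

text \<open>Besides \<open>\<alpha>\<close>, the depth \<open>K\<close> depends on the sign of
  \<open>p\<close>, on \<open>q\<close> and on \<open>e\<close>, but not on \<open>p\<close> itself,
  so one neighbourhood of \<open>\<alpha>\<close> serves all these \<open>p\<close>. The value
  \<open>L p\<close> comes from \<open>Phi\<close> at \<open>\<alpha>\<close> and its second
  iterate; it may depend on \<open>e\<close> through \<open>K\<close>, so what is asserted is small
  oscillation, not yet a limit.\<close>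

lemma h_approx:
  assumes \<alpha>: "\<alpha> \<in> {0<..<1} - \<rat>" and sup: "(SUP k. enat (partial_quotient \<alpha> (2 * k + (if \<sigma> then 2 else 1)))) = \<infinity>"
    and q: "0 < q" and e: "0 < e"
  shows "\<exists>L. \<forall>\<^sub>F r in rat_at \<alpha>. \<forall>p. (0 < p) = \<sigma> \<and> q \<le> \<bar>p\<bar> \<longrightarrow> \<bar>h (ereal p) r - L p\<bar> \<le> e"
proof -
  \<comment> \<open>This gives \<open>16 * d \<le> e / 4\<close>. The four errors get a quarter
    each: variation of \<open>Phi\<close> near the centre, the tail, and convergence of
    \<open>Phi\<close> at \<open>r\<close> and at its second iterate.\<close>
  define d where "d = min (1 / 8) (e / 64)"
  have d: "0 < d" "d < 1 / 4" "d < 1" "64 * d \<le> e" using e by (auto simp: d_def)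
  have e4: "e / 4 > 0" using e by simp
  obtain x0 where x0: "x0 > 0"
    "\<And>p x. 0 < x \<Longrightarrow> x \<le> x0 \<Longrightarrow> q \<le> \<bar>p\<bar> \<Longrightarrow> conc_err p d x * exp (16 * \<bar>p\<bar>) \<le> \<bar>p\<bar> * (e / 4)"
    using conc_err_small[OF d(1,3) q e4] by blast
  have "min x0 (d / 2) > 0" using x0 d by simp
  moreover have "(1::nat) \<le> (if \<sigma> then 2 else 1)" by simp
  ultimately obtain K where
    K: "K \<ge> 2" "even K = even ((if \<sigma> then 2 else 1) - (1::nat))" "(gauss_map ^^ K) \<alpha> < min x0 (d / 2)"
    using large_partial_quotient[OF \<alpha> sup] by metis
  \<comment> \<open>\<open>K\<close> is odd for positive \<open>p\<close> and even for negative
    \<open>p\<close>, so the exponent at depth \<open>K\<close> is negative, as concentration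
    requires.\<close>
  have s: "(- 1) ^ K * p < 0" if "(0 < p) = \<sigma>" "q \<le> \<bar>p\<bar>" for p :: real
    using that K(2) q by (cases \<sigma>) (auto simp: minus_one_power_iff)
  define \<alpha>' where "\<alpha>' = (gauss_map ^^ 2) \<alpha>"
  define L where "L p = (ln (Phi p \<alpha> K False (1 / 2)) - ln (Phi p \<alpha>' (K - 2) False (1 / 2))) / p" for p
  have id: "((\<lambda>r. r) \<longlongrightarrow> \<alpha>) (rat_at \<alpha>)" by (rule tendsto_ident_at)
  have \<alpha>': "\<alpha>' \<in> {0<..<1} - \<rat>" unfolding \<alpha>'_def by (rule gauss_map_funpow_irrational[OF \<alpha>])
  have in01: "\<forall>\<^sub>F r in rat_at \<alpha>. \<forall>i\<in>{..Suc K}. (gauss_map ^^ i) r \<in> {0<..<1}"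
  proof (rule eventually_ball_finite)
    show "\<forall>i\<in>{..Suc K}. \<forall>\<^sub>F r in rat_at \<alpha>. (gauss_map ^^ i) r \<in> {0<..<1}"
    proof
      fix i
      have "(gauss_map ^^ i) \<alpha> \<in> {0<..<1}" using gauss_map_funpow_irrational[OF \<alpha>] by blast
      then show "\<forall>\<^sub>F r in rat_at \<alpha>. (gauss_map ^^ i) r \<in> {0<..<1}"
        by (intro topological_tendstoD[OF gauss_map_funpow_tendsto[OF id \<alpha>]]) auto
    qed
  qed simp
  have small: "\<forall>\<^sub>F r in rat_at \<alpha>. (gauss_map ^^ K) r < min x0 (d / 2)"
    by (rule order_tendstoD(2)[OF gauss_map_funpow_tendsto[OF id \<alpha>] K(3)])
  have rat: "\<forall>\<^sub>F r in rat_at \<alpha>. r \<in> \<rat>" by (auto simp: eventually_at_filter)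
  have it: "(gauss_map ^^ i) ((gauss_map ^^ 2) r) = (gauss_map ^^ (i + 2)) r" for i r
    by (simp only: funpow_add o_apply)
  have pos: "0 < Phi p r K False (1 / 2)" "0 < Phi p ((gauss_map ^^ 2) r) (K - 2) False (1 / 2)"
    if "\<forall>i\<in>{..Suc K}. (gauss_map ^^ i) r \<in> {0<..<1}" "(gauss_map ^^ K) r < min x0 (d / 2)" for p r
  proof -
    have z: "0 < (gauss_map ^^ K) r" "(gauss_map ^^ K) r \<le> 1 / 8" using that d by force+
    show "0 < Phi p r K False (1 / 2)"
      by (rule Phi_near_far(3)[OF _ z d(2)]) (use that in auto)
    have e: "(gauss_map ^^ (K - 2)) ((gauss_map ^^ 2) r) = (gauss_map ^^ K) r"
      using K(1) by (simp only: it le_add_diff_inverse2)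
    show "0 < Phi p ((gauss_map ^^ 2) r) (K - 2) False (1 / 2)"
    proof (rule Phi_near_far(3)[OF _ _ _ d(2)])
      fix i assume "i < K - 2"
      then have "i + 2 \<in> {..Suc K}" by simp
      then show "(gauss_map ^^ i) ((gauss_map ^^ 2) r) \<in> {0<..<1}" unfolding it using that(1) by blast
    qed (simp_all only: e z)
  qed
  have \<alpha>pos: "0 < Phi p \<alpha> K False (1 / 2)" "0 < Phi p \<alpha>' (K - 2) False (1 / 2)" for p
    using pos[of \<alpha> p] K(3) gauss_map_funpow_irrational[OF \<alpha>] unfolding \<alpha>'_def by blast+
  have close: "\<forall>\<^sub>F r in rat_at \<alpha>. \<forall>p. exp_close (\<bar>p\<bar> * (e / 4)) (Phi p r K False (1 / 2)) (Phi p \<alpha> K False (1 / 2))"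
    by (rule Phi_exp_close[OF id \<alpha> tendsto_const e4])
  have close': "\<forall>\<^sub>F r in rat_at \<alpha>. \<forall>p. exp_close (\<bar>p\<bar> * (e / 4))
      (Phi p ((gauss_map ^^ 2) r) (K - 2) False (1 / 2)) (Phi p \<alpha>' (K - 2) False (1 / 2))"
    unfolding \<alpha>'_def
    by (rule Phi_exp_close[OF gauss_map_funpow_tendsto[OF id \<alpha>] \<alpha>'[unfolded \<alpha>'_def] tendsto_const e4])
  have "\<forall>\<^sub>F r in rat_at \<alpha>. \<forall>p. (0 < p) = \<sigma> \<and> q \<le> \<bar>p\<bar> \<longrightarrow> \<bar>h (ereal p) r - L p\<bar> \<le> e"
    using in01 small rat close close'
  proof eventually_elim
    case (elim r)
    show ?case
    proof (intro allI impI)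
      fix p assume p: "(0 < p) = \<sigma> \<and> q \<le> \<bar>p\<bar>"
      then have p0: "p \<noteq> 0" "\<bar>p\<bar> > 0" using q by auto
      define A B C D where "A = ln (bsum p r) - ln (bsum p ((gauss_map ^^ 2) r))"
        and "B = ln (Phi p r K False (1 / 2)) - ln (Phi p ((gauss_map ^^ 2) r) (K - 2) False (1 / 2))"
        and "C = ln (Phi p \<alpha> K False (1 / 2)) - ln (Phi p \<alpha>' (K - 2) False (1 / 2))"
        and "D = conc_err p d ((gauss_map ^^ K) r) * exp (16 * \<bar>p\<bar>)"
      have z: "0 < (gauss_map ^^ K) r" using elim(1) by force
      have "\<bar>A - B\<bar> \<le> 16 * \<bar>p\<bar> * d + D"
        unfolding A_def B_def D_def
        by (rule ln_bsum_ratio[OF elim(3) _ K(1) _ d(2) s]) (use elim p in auto)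
      moreover have "D \<le> \<bar>p\<bar> * (e / 4)"
        unfolding D_def by (rule x0(2)) (use z elim p in auto)
      moreover have "64 * d * \<bar>p\<bar> \<le> e * \<bar>p\<bar>" using d(4) by (intro mult_right_mono) auto
      then have "16 * \<bar>p\<bar> * d \<le> \<bar>p\<bar> * (e / 4)" by (simp add: algebra_simps)
      moreover have "\<bar>B - C\<bar> \<le> \<bar>p\<bar> * (e / 4) + \<bar>p\<bar> * (e / 4)"
      proof -
        have "\<bar>ln (Phi p r K False (1 / 2)) - ln (Phi p \<alpha> K False (1 / 2))\<bar> \<le> \<bar>p\<bar> * (e / 4)"
          using elim(4) pos[OF elim(1,2)] \<alpha>pos by (intro exp_close_ln) auto
        moreover have "\<bar>ln (Phi p ((gauss_map ^^ 2) r) (K - 2) False (1 / 2)) - ln (Phi p \<alpha>' (K - 2) False (1 / 2))\<bar>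
            \<le> \<bar>p\<bar> * (e / 4)"
          using elim(5) pos[OF elim(1,2)] \<alpha>pos by (intro exp_close_ln) auto
        ultimately show ?thesis unfolding B_def C_def by linarith
      qed
      ultimately have AC: "\<bar>A - C\<bar> \<le> \<bar>p\<bar> * e" by linarith
      have "h (ereal p) r - L p = (A - C) / p"
        using h_real[OF elim(3) p0(1)] by (simp add: A_def C_def L_def diff_divide_distrib)
      then have "\<bar>h (ereal p) r - L p\<bar> = \<bar>A - C\<bar> / \<bar>p\<bar>" by (simp add: abs_divide)
      also have "\<dots> \<le> e" using AC p0 by (simp add: field_simps)
      finally show "\<bar>h (ereal p) r - L p\<bar> \<le> e" .
    qed
  qed
  then show ?thesis by blast
qed

section \<open>The cases of infinite \<open>p\<close>\<close>

lemma bsum_ln_approx: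
  assumes r: "r \<in> \<rat>" and N0: "N0 < reduced_denom r"
    and max: "\<And>N. N < reduced_denom r \<Longrightarrow> t * S N r \<le> t * S N0 r" and t: "t \<noteq> 0"
  shows "\<bar>ln (bsum t r) / t - S N0 r\<bar> \<le> ln (reduced_denom r) / \<bar>t\<bar>"
proof -
  define q where "q = reduced_denom r"
  have q: "q > 0" using N0 by (simp add: q_def)
  \<comment> \<open>A single term bounds the sum from below, the number of terms times the largest
    one from above. Since \<open>N0\<close> maximises \<open>t * S N r\<close>, both signs of
    \<open>t\<close> are covered.\<close>
  have "exp (t * S N0 r) \<le> bsum t r"
    unfolding bsum_def using N0 by (intro member_le_sum) auto
  then have 1: "t * S N0 r \<le> ln (bsum t r)" using bsum_pos[OF r] by (simp add: ln_ge_iff)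
  have "bsum t r \<le> real (card {..<q}) * exp (t * S N0 r)"
    unfolding bsum_def q_def[symmetric] using max q_def by (intro sum_bounded_above) auto
  then have "ln (bsum t r) \<le> ln (real q * exp (t * S N0 r))"
    using bsum_pos[OF r, of t] q by (subst ln_le_cancel_iff) auto
  then have 2: "ln (bsum t r) \<le> ln q + t * S N0 r" using q by (simp add: ln_mult)
  have "ln (bsum t r) / t - S N0 r = (ln (bsum t r) - t * S N0 r) / t" using t by (simp add: field_simps)
  then have "\<bar>ln (bsum t r) / t - S N0 r\<bar> = \<bar>ln (bsum t r) - t * S N0 r\<bar> / \<bar>t\<bar>" by simp
  also have "\<dots> \<le> ln q / \<bar>t\<bar>" using 1 2 by (intro divide_right_mono) auto
  finally show ?thesis by (simp add: q_def)
qed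

lemma J_infinite:
  assumes r: "r \<in> \<rat>"
  shows "((\<lambda>t. ln (bsum t r) / t) \<longlongrightarrow> ln (J \<infinity> r)) at_top" "J \<infinity> r > 0"
    and "((\<lambda>t. ln (bsum t r) / t) \<longlongrightarrow> ln (J (- \<infinity>) r)) at_bot" "J (- \<infinity>) r > 0"
proof -
  define q where "q = reduced_denom r"
  define V where "V = (\<lambda>N. exp (S N r)) ` {0..<q}"
  have q: "q > 0" using reduced_denom_pos[OF r] by (simp add: q_def)
  then have V: "finite V" "V \<noteq> {}" by (auto simp: V_def)
  have "filterlim (abs :: real \<Rightarrow> real) at_top at_bot"
    by (simp add: filterlim_at_bot_mirror filterlim_abs_real)
  then have lim: "((\<lambda>t. ln (real q) / \<bar>t\<bar>) \<longlongrightarrow> 0) F" if "F = at_top \<or> F = at_bot" for F :: "real filter"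
    using that by (auto intro!: tendsto_divide_0[OF tendsto_const] filterlim_at_top_imp_at_infinity
      filterlim_abs_real)
  have sq: "((\<lambda>t. ln (bsum t r) / t) \<longlongrightarrow> S N0 r) F"
    if "\<forall>\<^sub>F t in F. \<bar>ln (bsum t r) / t - S N0 r\<bar> \<le> ln q / \<bar>t\<bar>" "F = at_top \<or> F = at_bot" for N0 and F :: "real filter"
  proof (rule LIM_zero_cancel, rule tendsto_0_le[OF lim[OF that(2)], where K = 1])
    show "\<forall>\<^sub>F t in F. norm (ln (bsum t r) / t - S N0 r) \<le> norm (ln (real q) / \<bar>t\<bar>) * 1"
    proof (rule eventually_mono[OF that(1)])
      fix t assume "\<bar>ln (bsum t r) / t - S N0 r\<bar> \<le> ln q / \<bar>t\<bar>"
      then show "norm (ln (bsum t r) / t - S N0 r) \<le> norm (ln (real q) / \<bar>t\<bar>) * 1"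
        using abs_ge_self[of "ln q / \<bar>t\<bar>"] by simp
    qed
  qed
  have JM: "J \<infinity> r = Max V" "J (- \<infinity>) r = Min V" by (auto simp: J_def V_def q_def)
  obtain N0 where N0: "N0 < q" "Max V = exp (S N0 r)" using Max_in[OF V] by (auto simp: V_def)
  have "S N r \<le> S N0 r" if "N < q" for N
  proof -
    have "exp (S N r) \<le> Max V" using V that by (intro Max_ge) (auto simp: V_def)
    then show ?thesis using N0 by simp
  qed
  then have "\<forall>\<^sub>F t in at_top. \<bar>ln (bsum t r) / t - S N0 r\<bar> \<le> ln q / \<bar>t\<bar>"
    unfolding q_def using N0 by (intro eventually_mono[OF eventually_gt_at_top[of 0]] bsum_ln_approx[OF r])
      (auto simp: q_def)
  from sq[OF this] show "((\<lambda>t. ln (bsum t r) / t) \<longlongrightarrow> ln (J \<infinity> r)) at_top" "J \<infinity> r > 0"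
    using N0 JM by auto
  obtain N1 where N1: "N1 < q" "Min V = exp (S N1 r)" using Min_in[OF V] by (auto simp: V_def)
  have "S N1 r \<le> S N r" if "N < q" for N
  proof -
    have "Min V \<le> exp (S N r)" using V that by (intro Min_le) (auto simp: V_def)
    then show ?thesis using N1 by simp
  qed
  then have "\<forall>\<^sub>F t in at_bot. \<bar>ln (bsum t r) / t - S N1 r\<bar> \<le> ln q / \<bar>t\<bar>"
    unfolding q_def using N1 by (intro eventually_mono[OF eventually_gt_at_bot[of 0]] bsum_ln_approx[OF r])
      (auto simp: q_def)
  from sq[OF this] show "((\<lambda>t. ln (bsum t r) / t) \<longlongrightarrow> ln (J (- \<infinity>) r)) at_bot" "J (- \<infinity>) r > 0"
    using N1 JM by auto
qed

lemma h_infinite: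
  assumes r: "r \<in> \<rat>"
  shows "((\<lambda>t. h (ereal t) r) \<longlongrightarrow> h \<infinity> r) at_top"
    and "((\<lambda>t. h (ereal t) r) \<longlongrightarrow> h (- \<infinity>) r) at_bot"
proof -
  define r' where "r' = (gauss_map ^^ 2) r"
  have r': "r' \<in> \<rat>" using gauss_map_funpow_rat[OF r] by (simp add: r'_def)
  have e: "ln (bsum t r) / t - ln (bsum t r') / t = h (ereal t) r" if "t \<noteq> 0" for t
    using h_real[OF r that] by (simp add: r'_def diff_divide_distrib)
  have "((\<lambda>t. ln (bsum t r) / t - ln (bsum t r') / t) \<longlongrightarrow> h \<infinity> r) at_top"
    using tendsto_diff[OF J_infinite(1)[OF r] J_infinite(1)[OF r']] J_infinite(2)[OF r] J_infinite(2)[OF r']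
    by (simp add: h_def ln_div flip: r'_def)
  then show "((\<lambda>t. h (ereal t) r) \<longlongrightarrow> h \<infinity> r) at_top"
    by (rule Lim_transform_eventually) (use eventually_gt_at_top[of 0] in eventually_elim, auto intro: e)
  have "((\<lambda>t. ln (bsum t r) / t - ln (bsum t r') / t) \<longlongrightarrow> h (- \<infinity>) r) at_bot"
    using tendsto_diff[OF J_infinite(3)[OF r] J_infinite(3)[OF r']] J_infinite(4)[OF r] J_infinite(4)[OF r']
    by (simp add: h_def ln_div flip: r'_def)
  then show "((\<lambda>t. h (ereal t) r) \<longlongrightarrow> h (- \<infinity>) r) at_bot"
    by (rule Lim_transform_eventually) (use eventually_gt_at_bot[of 0] in eventually_elim, auto intro: e)
qed

lemma rat_at_nontrivial:
  assumes "x \<in> {0<..<1}"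
  shows "rat_at x \<noteq> bot"
proof -
  have "\<exists>r\<in>{0..<1} \<inter> \<rat>. r \<noteq> x \<and> dist r x < e" if "e > 0" for e
  proof -
    have "x < min 1 (x + e)" using assms that by auto
    then obtain q where "q \<in> \<rat>" "x < q" "q < min 1 (x + e)" using Rats_dense_in_real by blast
    then show ?thesis using assms by (intro bexI[of _ q]) (auto simp: dist_real_def)
  qed
  then have "\<not> eventually (\<lambda>_. False) (rat_at x)"
    unfolding eventually_at by blast
  then show ?thesis by (auto simp: eventually_False)
qed

lemma h_oscillation:
  assumes \<alpha>: "\<alpha> \<in> {0<..<1} - \<rat>" and sup: "(SUP k. enat (partial_quotient \<alpha> (2 * k + eps p))) = \<infinity>"
    and p: "p \<noteq> 0" and e: "0 < e"
  shows "\<exists>L. \<forall>\<^sub>F r in rat_at \<alpha>. \<bar>h p r - L\<bar> \<le> e"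
proof -
  have eps: "eps p = (if p > 0 then 2 else 1)" by (simp add: eps_def)
  have rat: "\<forall>\<^sub>F r in rat_at \<alpha>. r \<in> \<rat>" by (auto simp: eventually_at_filter)
  have nontriv: "rat_at \<alpha> \<noteq> bot" using \<alpha> by (intro rat_at_nontrivial) auto
  have limit: "\<exists>L. \<forall>\<^sub>F r in rat_at \<alpha>. \<bar>h p r - L\<bar> \<le> e"
    if F: "F \<noteq> bot" "\<And>r. r \<in> \<rat> \<Longrightarrow> ((\<lambda>t. h (ereal t) r) \<longlongrightarrow> h p r) F"
      "\<forall>\<^sub>F t in F. (0 < t) = (p > 0) \<and> 1 \<le> \<bar>t\<bar>" for F :: "real filter"
  proof -
    obtain L :: "real \<Rightarrow> real" where "\<forall>\<^sub>F r in rat_at \<alpha>. \<forall>t. (0 < t) = (p > 0) \<and> 1 \<le> \<bar>t\<bar> \<longrightarrow> \<bar>h (ereal t) r - L t\<bar> \<le> e / 2"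
      using h_approx[OF \<alpha> sup[unfolded eps], of 1 "e / 2"] e by auto
    with rat have ev: "\<forall>\<^sub>F r in rat_at \<alpha>. r \<in> \<rat> \<and> (\<forall>t. (0 < t) = (p > 0) \<and> 1 \<le> \<bar>t\<bar> \<longrightarrow> \<bar>h (ereal t) r - L t\<bar> \<le> e / 2)"
      by (rule eventually_conj)
    \<comment> \<open>Comparison with a fixed rational \<open>r0\<close> eliminates
      \<open>L t\<close>, whose behaviour as \<open>t\<close> varies is not controlled; the
      resulting bound on the difference of two values of \<open>h\<close> passes to the limit in
      \<open>t\<close>.\<close>
    then obtain r0 where r0: "r0 \<in> \<rat>" "\<And>t. (0 < t) = (p > 0) \<and> 1 \<le> \<bar>t\<bar> \<Longrightarrow> \<bar>h (ereal t) r0 - L t\<bar> \<le> e / 2"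
      using eventually_happens'[OF nontriv ev] by blast
    show ?thesis
    proof (intro exI[of _ "h p r0"], rule eventually_mono[OF ev])
      fix r assume r: "r \<in> \<rat> \<and> (\<forall>t. (0 < t) = (p > 0) \<and> 1 \<le> \<bar>t\<bar> \<longrightarrow> \<bar>h (ereal t) r - L t\<bar> \<le> e / 2)"
      have "((\<lambda>t. \<bar>h (ereal t) r - h (ereal t) r0\<bar>) \<longlongrightarrow> \<bar>h p r - h p r0\<bar>) F"
        using r r0 by (intro tendsto_rabs tendsto_diff F(2)) auto
      moreover have "\<forall>\<^sub>F t in F. \<bar>h (ereal t) r - h (ereal t) r0\<bar> \<le> e"
      proof (rule eventually_mono[OF F(3)])
        fix t :: real assume t: "(0 < t) = (p > 0) \<and> 1 \<le> \<bar>t\<bar>"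
        have "\<bar>h (ereal t) r - L t\<bar> \<le> e / 2" "\<bar>h (ereal t) r0 - L t\<bar> \<le> e / 2"
          using r r0(2) t by blast+
        then show "\<bar>h (ereal t) r - h (ereal t) r0\<bar> \<le> e" by linarith
      qed
      ultimately show "\<bar>h p r - h p r0\<bar> \<le> e" using F(1) by (rule tendsto_upperbound)
    qed
  qed
  show ?thesis
  proof (cases p)
    case (real t)
    then have t: "t \<noteq> 0" "(0 < p) = (0 < t)" using p by auto
    obtain L :: "real \<Rightarrow> real" where L: "\<forall>\<^sub>F r in rat_at \<alpha>. \<forall>u. (0 < u) = (p > 0) \<and> \<bar>t\<bar> \<le> \<bar>u\<bar> \<longrightarrow> \<bar>h (ereal u) r - L u\<bar> \<le> e"
      using h_approx[OF \<alpha> sup[unfolded eps], of "\<bar>t\<bar>" e] e t by auto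
    show ?thesis
      by (rule exI[of _ "L t"], rule eventually_mono[OF L]) (use t real in auto)
  next
    case PInf
    show ?thesis
    proof (rule limit[of at_top])
      show "\<forall>\<^sub>F t in at_top. (0 < t) = (p > 0) \<and> 1 \<le> \<bar>t::real\<bar>"
        by (rule eventually_mono[OF eventually_ge_at_top[of 1]]) (use PInf in auto)
    qed (use PInf h_infinite in auto)
  next
    case MInf
    show ?thesis
    proof (rule limit[of at_bot])
      show "\<forall>\<^sub>F t in at_bot. (0 < t) = (p > 0) \<and> 1 \<le> \<bar>t::real\<bar>"
        by (rule eventually_mono[OF eventually_le_at_bot[of "-1"]]) (use MInf in auto)
    qed (use MInf h_infinite in auto)
  qed
qed

section \<open>From small oscillation to the limit and the extension\<close>

lemma tendsto_if_oscillation_small: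
  fixes f :: "'a \<Rightarrow> real"
  assumes F: "F \<noteq> bot" and osc: "\<And>e. 0 < e \<Longrightarrow> \<exists>L. \<forall>\<^sub>F x in F. \<bar>f x - L\<bar> \<le> e"
  shows "\<exists>L. (f \<longlongrightarrow> L) F"
proof -
  have "\<forall>n. \<exists>L. \<forall>\<^sub>F x in F. \<bar>f x - L\<bar> \<le> inverse (Suc n)" using osc by simp
  then obtain L where L: "\<And>n. \<forall>\<^sub>F x in F. \<bar>f x - L n\<bar> \<le> inverse (Suc n)" by metis
  \<comment> \<open>As \<open>F\<close> is nontrivial, two of the approximations hold at a common
    point, which makes \<open>L\<close> a Cauchy sequence.\<close>
  have LL: "\<bar>L m - L n\<bar> \<le> inverse (Suc m) + inverse (Suc n)" for m n
    using eventually_happens'[OF F eventually_conj[OF L[of m] L[of n]]] by linarith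
  have "Cauchy L"
  proof (rule CauchyI)
    fix e :: real assume "0 < e"
    then obtain k where k: "inverse (real (Suc k)) < e / 2" using reals_Archimedean[of "e / 2"] by auto
    have "norm (L m - L n) < e" if "m \<ge> k" "n \<ge> k" for m n
    proof -
      have "inverse (real (Suc m)) \<le> inverse (real (Suc k))" "inverse (real (Suc n)) \<le> inverse (real (Suc k))"
        using that by (auto intro!: le_imp_inverse_le)
      then show ?thesis using LL[of m n] k by (simp only: real_norm_def)
    qed
    then show "\<exists>M. \<forall>m\<ge>M. \<forall>n\<ge>M. norm (L m - L n) < e" by blast
  qed
  then obtain l where l: "L \<longlonglongrightarrow> l" using Cauchy_convergent convergent_def by blast
  have "(f \<longlongrightarrow> l) F"
  proof (rule tendstoI)
    fix e :: real assume e: "0 < e"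
    then obtain k where k: "inverse (real (Suc k)) < e / 2" using reals_Archimedean[of "e / 2"] by auto
    have "\<forall>\<^sub>F n in sequentially. n \<ge> k \<and> dist (L n) l < e / 2"
      using tendstoD[OF l, of "e / 2"] e by (intro eventually_conj eventually_ge_at_top) auto
    then obtain n where n: "n \<ge> k" "dist (L n) l < e / 2"
      using eventually_happens'[OF sequentially_bot] by blast
    have "inverse (real (Suc n)) \<le> inverse (real (Suc k))" using n by (auto intro!: le_imp_inverse_le)
    then have "dist y l < e" if "\<bar>y - L n\<bar> \<le> inverse (real (Suc n))" for y
      using that n(2) k unfolding dist_real_def by linarith
    then show "\<forall>\<^sub>F x in F. dist (f x) l < e"
      by (rule eventually_mono[OF L[of n]])
  qed
  then show ?thesis ..
qed

lemma extension_continuous_at_limits: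
  fixes f :: "real \<Rightarrow> real"
  obtains H where "\<And>r. r \<in> {0..<1} \<inter> \<rat> \<Longrightarrow> H r = f r"
    "\<And>\<alpha> L. \<alpha> \<in> {0<..<1} - \<rat> \<Longrightarrow> (f \<longlongrightarrow> L) (rat_at \<alpha>) \<Longrightarrow> continuous (at \<alpha> within {0..1}) H"
proof -
  \<comment> \<open>The lower limit along rationals always exists in \<open>ereal\<close>, agrees
    with the limit where there is one, and obeys any bounds valid near the point. An infinite value
    becomes 0 under \<open>real_of_ereal\<close>.\<close>
  define H where "H x = (if x \<in> {0..<1} \<inter> \<rat> then f x
    else real_of_ereal (Liminf (rat_at x) (\<lambda>r. ereal (f r))))" for x
  show ?thesis
  proof (rule that[of H])
    fix \<alpha> L assume \<alpha>: "\<alpha> \<in> {0<..<1} - \<rat>" and L: "(f \<longlongrightarrow> L) (rat_at \<alpha>)"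
    have HL: "\<bar>H x - L\<bar> \<le> e" if x: "x \<in> {0<..<1} - \<rat>" and ev: "\<forall>\<^sub>F r in rat_at x. \<bar>f r - L\<bar> \<le> e" for x e
    proof -
      have nt: "rat_at x \<noteq> bot" using x by (intro rat_at_nontrivial) auto
      define l where "l = Liminf (rat_at x) (\<lambda>r. ereal (f r))"
      have "ereal (L - e) \<le> l" unfolding l_def
        by (rule Liminf_bounded) (rule eventually_mono[OF ev], auto)
      moreover have "l \<le> ereal (L + e)" unfolding l_def
        by (rule Liminf_le[OF nt]) (rule eventually_mono[OF ev], auto)
      ultimately obtain z where "l = ereal z" "L - e \<le> z" "z \<le> L + e" by (cases l) auto
      then show ?thesis using x by (auto simp: H_def l_def)
    qed
    have H\<alpha>: "H \<alpha> = L"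
    proof -
      have "\<bar>H \<alpha> - L\<bar> \<le> e" if "e > 0" for e
        by (rule HL[OF \<alpha>]) (rule eventually_mono[OF tendstoD[OF L that]], simp add: dist_real_def)
      then have "\<bar>H \<alpha> - L\<bar> \<le> 0" by (rule field_le_epsilon) simp
      then show ?thesis by simp
    qed
    show "continuous (at \<alpha> within {0..1}) H"
      unfolding continuous_within H\<alpha>
    proof (rule tendstoI)
      fix e :: real assume e: "0 < e"
      have "\<forall>\<^sub>F r in rat_at \<alpha>. dist (f r) L < e / 2" using tendstoD[OF L, of "e / 2"] e by simp
      then obtain d where d: "d > 0" "\<And>r. r \<in> {0..<1} \<inter> \<rat> \<Longrightarrow> r \<noteq> \<alpha> \<Longrightarrow> dist r \<alpha> < d \<Longrightarrow> dist (f r) L < e / 2"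
        unfolding eventually_at by blast
      \<comment> \<open>The radius \<open>1 - \<alpha>\<close> keeps \<open>x\<close> below 1, so
        that \<open>H\<close> and \<open>f\<close> agree at a rational \<open>x\<close>.\<close>
      have "dist (H x) L < e" if x: "x \<in> {0..1}" "x \<noteq> \<alpha>" "dist x \<alpha> < min d (1 - \<alpha>)" for x
      proof -
        have x1: "x < 1" "x \<ge> 0" "dist x \<alpha> < d" using x by (auto simp: dist_real_def)
        show ?thesis
        proof (cases "x \<in> \<rat>")
          case True
          then show ?thesis using d(2)[of x] x x1 e by (simp add: H_def)
        next
          case False
          then have xi: "x \<in> {0<..<1} - \<rat>" using x1 by (cases "x = 0") auto
          \<comment> \<open>A small ball about \<open>x\<close> lies in the ball of radius
            \<open>d\<close> about \<open>\<alpha>\<close>, so the bound on \<open>f\<close> there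
            passes to the lower limit at \<open>x\<close>.\<close>
          have "\<bar>H x - L\<bar> \<le> e / 2"
          proof (rule HL[OF xi])
            have "\<forall>\<^sub>F r in rat_at x. dist r x < d - dist x \<alpha>"
              using x1 by (intro tendstoD[OF tendsto_ident_at]) simp
            moreover have "\<forall>\<^sub>F r in rat_at x. r \<in> {0..<1} \<inter> \<rat>" by (auto simp: eventually_at_filter)
            ultimately show "\<forall>\<^sub>F r in rat_at x. \<bar>f r - L\<bar> \<le> e / 2"
            proof eventually_elim
              case (elim r)
              have "dist r \<alpha> < d" using elim(1) dist_triangle[of r \<alpha> x] by linarith
              moreover have "r \<noteq> \<alpha>" using elim(2) \<alpha> by auto
              ultimately have "dist (f r) L < e / 2" using elim(2) d(2) by blast
              then show ?case by (simp add: dist_real_def)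
            qed
          qed
          then show ?thesis using e by (simp add: dist_real_def)
        qed
      qed
      moreover have "min d (1 - \<alpha>) > 0" using d \<alpha> by simp
      ultimately show "\<forall>\<^sub>F x in at \<alpha> within {0..1}. dist (H x) L < e"
        unfolding eventually_at by blast
    qed
  qed (simp add: H_def)
qed

theorem theorem3:
  fixes p :: ereal
  assumes "p \<noteq> 0"
  shows "(\<forall>\<alpha>::real. \<alpha> \<in> {0<..<1} - \<rat> \<and> (SUP k. enat (partial_quotient \<alpha> (2 * k + eps p))) = \<infinity> \<longrightarrow>
            (\<exists>L::real. (h p \<longlongrightarrow> L) (at \<alpha> within {0..<1} \<inter> \<rat>))) \<and>
         (\<exists>H::real \<Rightarrow> real.
            (\<forall>r \<in> {0..<1} \<inter> \<rat>. H r = h p r) \<and>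
            (\<forall>\<alpha>::real. \<alpha> \<in> {0<..<1} - \<rat> \<and> (SUP k. enat (partial_quotient \<alpha> (2 * k + eps p))) = \<infinity> \<longrightarrow>
               continuous (at \<alpha> within {0..1}) H))"
proof -
  have lim: "\<exists>L. (h p \<longlongrightarrow> L) (rat_at \<alpha>)"
    if "\<alpha> \<in> {0<..<1} - \<rat>" "(SUP k. enat (partial_quotient \<alpha> (2 * k + eps p))) = \<infinity>" for \<alpha>
    using that by (intro tendsto_if_oscillation_small rat_at_nontrivial h_oscillation assms) auto
  obtain H where H: "\<And>r. r \<in> {0..<1} \<inter> \<rat> \<Longrightarrow> H r = h p r"
    "\<And>\<alpha> L. \<alpha> \<in> {0<..<1} - \<rat> \<Longrightarrow> (h p \<longlongrightarrow> L) (rat_at \<alpha>) \<Longrightarrow> continuous (at \<alpha> within {0..1}) H"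
    using extension_continuous_at_limits by blast
  have "\<forall>r \<in> {0..<1} \<inter> \<rat>. H r = h p r" by (intro ballI H(1))
  moreover have "continuous (at \<alpha> within {0..1}) H"
    if "\<alpha> \<in> {0<..<1} - \<rat>" "(SUP k. enat (partial_quotient \<alpha> (2 * k + eps p))) = \<infinity>" for \<alpha>
    using lim[OF that] H(2)[OF that(1)] by (elim exE)
  ultimately show ?thesis using lim by meson
qed

end
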